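(* There is a universal constant $C$ such that the following holds for every integer $d \ge 1$. Let $T$ be any $\mathbb{R}^d$-valued random variable, and let $Z$ be a standard $d$-dimensional Gaussian (mean zero, identity covariance). Then $$ \Delta_{CI}(T, Z) \le C\, d^{1/6}\, \mathcal{W}_2(T, Z)^{2/3}. $$
   Context: For Borel probability measures $\mu, \nu$ on $\mathbb{R}^d$, the convex-indicator distance is $$\Delta_{CI}(\mu,\nu) = \sup_{A} |\mu(A) - \nu(A)|,$$ the supremum being over all (Borel) convex sets $A \subset \mathbb{R}^d$. The quadratic transportation (Wasserstein) distance is $$\mathcal{W}_2(\mu,\nu) = \left( \inf_{\gamma \in \Gamma(\mu,\nu)} \int \|x-y\|^2 \, d\gamma(x,y) \right)^{1/2} \in [0,\infty],$$ where $\|\cdot\|$ is the Euclidean norm and $\Gamma(\mu,\nu)$ is the set of probability measures on $\mathbb{R}^d \times \mathbb{R}^d$ with marginals $\mu$ and $\nu$. For random vectors $X, Y$ with laws $\mu, \nu$, one writes $\Delta_{CI}(X,Y) = \Delta_{CI}(\mu,\nu)$ and $\mathcal{W}_2(X,Y) = \mathcal{W}_2(\mu,\nu)$. *)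

theory Defs
  imports "HOL-Probability.Probability"
begin

text \<open>
  The dimension \<open>d\<close> has to be quantified inside the formula, below the universal constant, so it
  cannot be a type. A point of the Euclidean space of dimension \<open>d\<close> is a function on \<open>{..<d}\<close>,
  extended by \<open>undefined\<close>; the Borel sigma-algebra is the product of \<open>d\<close> copies of that of the line.
\<close>

definition euclid :: "nat \<Rightarrow> (nat \<Rightarrow> real) measure" where
  "euclid d = Pi\<^sub>M {..<d} (\<lambda>_. borel)"

definition edist :: "nat \<Rightarrow> (nat \<Rightarrow> real) \<Rightarrow> (nat \<Rightarrow> real) \<Rightarrow> real" where
  "edist d x y = L2_set (\<lambda>i. x i - y i) {..<d}"

text \<open>The type \<open>nat \<Rightarrow> real\<close> is not an instance of \<open>real_vector\<close>, so the library's \<open>convex\<close> is not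
  available; this is the same definition with the operations of the space of dimension \<open>d\<close>.\<close>

definition convex_in :: "nat \<Rightarrow> (nat \<Rightarrow> real) set \<Rightarrow> bool" where
  "convex_in d A \<longleftrightarrow> A \<subseteq> space (euclid d) \<and>
     (\<forall>x\<in>A. \<forall>y\<in>A. \<forall>u\<ge>0. \<forall>v\<ge>0. u + v = 1 \<longrightarrow> (\<lambda>i\<in>{..<d}. u * x i + v * y i) \<in> A)"

definition prob_measures :: "nat \<Rightarrow> (nat \<Rightarrow> real) measure set" where
  "prob_measures d = {\<mu>. prob_space \<mu> \<and> sets \<mu> = sets (euclid d)}"

definition std_gaussian :: "nat \<Rightarrow> (nat \<Rightarrow> real) measure" where
  "std_gaussian d = density (Pi\<^sub>M {..<d} (\<lambda>_. lborel))
     (\<lambda>x. ennreal ((2 * pi) powr (- real d / 2) * exp (- (L2_set x {..<d})\<^sup>2 / 2)))"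

definition Delta_CI :: "nat \<Rightarrow> (nat \<Rightarrow> real) measure \<Rightarrow> (nat \<Rightarrow> real) measure \<Rightarrow> real" where
  "Delta_CI d \<mu> \<nu> = (SUP A \<in> {A \<in> sets (euclid d). convex_in d A}. \<bar>measure \<mu> A - measure \<nu> A\<bar>)"

definition couplings ::
  "nat \<Rightarrow> (nat \<Rightarrow> real) measure \<Rightarrow> (nat \<Rightarrow> real) measure \<Rightarrow> ((nat \<Rightarrow> real) \<times> (nat \<Rightarrow> real)) measure set" where
  "couplings d \<mu> \<nu> = {\<gamma>. prob_space \<gamma> \<and> sets \<gamma> = sets (euclid d \<Otimes>\<^sub>M euclid d) \<and>
     distr \<gamma> (euclid d) fst = \<mu> \<and> distr \<gamma> (euclid d) snd = \<nu>}"

text \<open>Real powers on \<open>[0, \<infinity>]\<close>; only positive exponents are meant.\<close>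

definition ennpowr :: "ennreal \<Rightarrow> real \<Rightarrow> ennreal" where
  "ennpowr x p = (if x = \<infinity> then \<infinity> else ennreal (enn2real x powr p))"

definition W2 :: "nat \<Rightarrow> (nat \<Rightarrow> real) measure \<Rightarrow> (nat \<Rightarrow> real) measure \<Rightarrow> ennreal" where
  "W2 d \<mu> \<nu> = ennpowr
     (INF \<gamma> \<in> couplings d \<mu> \<nu>. \<integral>\<^sup>+ (x, y). ennreal ((edist d x y)\<^sup>2) \<partial>\<gamma>) (1 / 2)"

lemma space_euclid: "space (euclid d) = ({..<d} \<rightarrow>\<^sub>E UNIV)"
  by (simp add: euclid_def space_PiM)

lemma std_gaussian_eq_PiM:
  "std_gaussian d = Pi\<^sub>M {..<d} (\<lambda>_. density lborel (\<lambda>x. ennreal (std_normal_density x)))"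
  (is "_ = Pi\<^sub>M _ (\<lambda>_. ?N)")
proof -
  interpret L: product_sigma_finite "\<lambda>_::nat. lborel :: real measure"
    by standard
  have pN: "prob_space ?N"
    by (rule prob_space_normal_density) simp
  interpret N: product_prob_space "\<lambda>_::nat. ?N"
    using pN by (auto simp: product_prob_space_def product_prob_space_axioms_def
        product_sigma_finite_def prob_space_imp_sigma_finite)
  have S: "sets (Pi\<^sub>M {..<d} (\<lambda>_. lborel :: real measure)) = sets (Pi\<^sub>M {..<d} (\<lambda>_. ?N))"
    by (intro sets_PiM_cong) auto
  have dens: "ennreal ((2 * pi) powr (- real d / 2) * exp (- (L2_set x {..<d})\<^sup>2 / 2))
     = (\<Prod>i<d. ennreal (std_normal_density (x i)))" for x :: "nat \<Rightarrow> real"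
  proof -
    have "(\<Prod>i<d. std_normal_density (x i)) = (1 / sqrt (2 * pi)) ^ d * exp (\<Sum>i<d. - (x i)\<^sup>2 / 2)"
      by (simp only: std_normal_density_def prod.distrib exp_sum finite_lessThan) simp
    moreover have "(1 / sqrt (2 * pi)) ^ d = (2 * pi) powr (- real d / 2)"
    proof -
      have "1 / sqrt (2 * pi) = (2 * pi) powr (- 1 / 2)"
        by (simp add: powr_minus_divide powr_half_sqrt)
      moreover have "((2 * pi) powr (- 1 / 2)) ^ d = (2 * pi) powr (- real d / 2)"
        by (simp add: powr_realpow[symmetric] powr_powr)
      ultimately show ?thesis by simp
    qed
    moreover have "(\<Sum>i<d. - (x i)\<^sup>2 / 2) = - (L2_set x {..<d})\<^sup>2 / 2"
      by (simp add: L2_set_def sum_nonneg sum_negf sum_divide_distrib)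
    ultimately show ?thesis
      by (simp add: prod_ennreal)
  qed
  show ?thesis
  proof (rule N.PiM_eqI)
    show "finite {..<d}" by simp
    show "sets (std_gaussian d) = sets (Pi\<^sub>M {..<d} (\<lambda>_. ?N))"
      by (simp add: std_gaussian_def S)
  next
    fix A :: "nat \<Rightarrow> real set" assume A: "\<And>i. i \<in> {..<d} \<Longrightarrow> A i \<in> sets ?N"
    then have A': "\<And>i. i < d \<Longrightarrow> A i \<in> sets borel" by simp
    have "emeasure (std_gaussian d) (Pi\<^sub>E {..<d} A) =
       (\<integral>\<^sup>+x. (\<Prod>i<d. ennreal (std_normal_density (x i))) * indicator (Pi\<^sub>E {..<d} A) x
          \<partial>Pi\<^sub>M {..<d} (\<lambda>_. lborel))"
      unfolding std_gaussian_def dens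
      using A' by (intro emeasure_density) (auto intro!: sets_PiM_I_finite)
    also have "\<dots> = (\<integral>\<^sup>+x. (\<Prod>i<d. ennreal (std_normal_density (x i)) * indicator (A i) (x i))
          \<partial>Pi\<^sub>M {..<d} (\<lambda>_. lborel))"
      by (intro nn_integral_cong)
        (auto simp: prod.distrib space_PiM PiE_def Pi_def indicator_def extensional_def)
    also have "\<dots> = (\<Prod>i<d. \<integral>\<^sup>+x. ennreal (std_normal_density x) * indicator (A i) x \<partial>lborel)"
      using A' by (intro L.product_nn_integral_prod) auto
    also have "\<dots> = (\<Prod>i<d. emeasure ?N (A i))"
      using A' by (intro prod.cong) (auto simp: emeasure_density)
    finally show "emeasure (std_gaussian d) (Pi\<^sub>E {..<d} A) = (\<Prod>i<d. emeasure ?N (A i))" .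
  qed
qed

lemma std_gaussian_prob_measures: "std_gaussian d \<in> prob_measures d"
proof -
  have "prob_space (std_gaussian d)"
    unfolding std_gaussian_eq_PiM
    by (intro prob_space_PiM prob_space_normal_density) simp
  moreover have "sets (std_gaussian d) = sets (euclid d)"
    unfolding std_gaussian_def euclid_def by (simp, intro sets_PiM_cong) auto
  ultimately show ?thesis by (simp add: prob_measures_def)
qed

text \<open>Quantifying over sample spaces would make the constant depend on the type of the sample
  points, so the theorem is stated for laws. It transfers with the same constant to random vectors
  on arbitrary, possibly different, probability spaces:\<close>

lemma law_bound_imp_random_vector_bound:
  fixes C :: real
  assumes "\<forall>\<mu> \<in> prob_measures d.
    ennreal (Delta_CI d \<mu> (std_gaussian d))
      \<le> ennreal (C * real d powr (1 / 6)) * ennpowr (W2 d \<mu> (std_gaussian d)) (2 / 3)"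
    and "prob_space M" "T \<in> M \<rightarrow>\<^sub>M euclid d"
    and "Z \<in> N \<rightarrow>\<^sub>M euclid d" "distr N (euclid d) Z = std_gaussian d"
  shows "ennreal (Delta_CI d (distr M (euclid d) T) (distr N (euclid d) Z))
      \<le> ennreal (C * real d powr (1 / 6)) *
         ennpowr (W2 d (distr M (euclid d) T) (distr N (euclid d) Z)) (2 / 3)"
  using assms by (simp add: prob_measures_def prob_space.prob_space_distr)

end

theory Submission
  imports Defs
begin

text \<open>
  By Markov's inequality for a coupling, the claim reduces to the fact (Ball, Nazarov) that a shell
  of width \<open>w\<close> around the boundary of a convex set has Gaussian measure \<open>O(d\<^sup>1\<^sup>/\<^sup>4 w)\<close>; the width is
  then optimised. Convex sets are first replaced by polyhedra \<open>{f \<le> 0}\<close>, where \<open>f\<close> is a finite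
  maximum of affine functions with unit normals, so that shells become slabs \<open>s \<le> f \<le> s + w\<close>.

  Let \<open>u x\<close> be the inner product of \<open>x\<close> with the normal of \<open>f\<close> at \<open>x\<close>, and let \<open>k\<close> be a bump of width
  \<open>w\<close> with primitive \<open>h\<close>. Two flows are compared. Dilations: \<open>f\<close> is convex, so the expectation of
  \<open>k(f) u\<close> is at most the derivative of the expectation of \<open>h(f(\<sigma> Z))\<close> at \<open>\<sigma> = 1\<close>, which is
  \<open>O(w \<surd>d)\<close> by the chi-square distance between the laws of \<open>\<sigma> Z\<close> and \<open>Z\<close>. Normal translation:
  moving every point for time \<open>t\<close> along the normal of its own cell maps the cell injectively into
  itself and increases \<open>f\<close> by \<open>t\<close>; integrating over \<open>t \<in> [0, \<tau>]\<close> bounds the expectation of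
  \<open>k(f) \<integral> exp (- t u - t\<^sup>2/2) dt\<close> by \<open>O(w)\<close>. For \<open>\<tau> = d\<^sup>-\<^sup>1\<^sup>/\<^sup>4\<close> the pointwise inequality
  \<open>1 \<le> \<tau> u + (C / \<tau>) \<integral> exp (- t u - t\<^sup>2/2) dt\<close> combines both into the shell bound.
\<close>

section \<open>Affine images of the standard Gaussian\<close>

definition dot :: "nat \<Rightarrow> (nat \<Rightarrow> real) \<Rightarrow> (nat \<Rightarrow> real) \<Rightarrow> real" where
  "dot d x y = (\<Sum>i<d. x i * y i)"

text \<open>Both sides are the product of the measures \<open>density (M i) (r i)\<close>, which
  boxes determine: the preimage of a box under a coordinatewise map is a box, and the integral of a
  product of functions of single coordinates factors.\<close>

lemma distr_PiM_density:
  fixes M :: "'i \<Rightarrow> 'a measure"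
  assumes I: "finite I" and M: "\<And>i. prob_space (M i)"
    and T [measurable]: "\<And>i. T i \<in> M i \<rightarrow>\<^sub>M M i"
    and r [measurable]: "\<And>i. r i \<in> borel_measurable (M i)"
    and eq: "\<And>i. distr (M i) (M i) (T i) = density (M i) (r i)"
  shows "distr (PiM I M) (PiM I M) (\<lambda>x. \<lambda>i\<in>I. T i (x i)) = density (PiM I M) (\<lambda>x. \<Prod>i\<in>I. r i (x i))"
proof -
  let ?D = "\<lambda>i. density (M i) (r i)"
  interpret M: product_prob_space M
    by (intro product_prob_spaceI M)
  have D: "prob_space (?D i)" for i
    unfolding eq[symmetric] by (intro prob_space.prob_space_distr M) simp
  interpret D: product_prob_space ?D
    by (intro product_prob_spaceI D)
  interpret F: finite_product_sigma_finite M I by standard fact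
  have S: "sets (PiM I ?D) = sets (PiM I M)"
    by (intro sets_PiM_cong) auto
  have "distr (PiM I M) (PiM I M) (\<lambda>x. \<lambda>i\<in>I. T i (x i)) = PiM I ?D"
  proof (rule D.PiM_eqI[OF I])
    fix A assume "\<And>i. i \<in> I \<Longrightarrow> A i \<in> sets (?D i)"
    then have A: "\<And>i. i \<in> I \<Longrightarrow> A i \<in> sets (M i)" by simp
    have A': "Pi\<^sub>E I A \<in> sets (PiM I M)" using A I by (intro sets_PiM_I_finite)
    have "emeasure (distr (PiM I M) (PiM I M) (\<lambda>x. \<lambda>i\<in>I. T i (x i))) (Pi\<^sub>E I A)
      = emeasure (PiM I M) (Pi\<^sub>E I (\<lambda>i. T i -` A i \<inter> space (M i)))"
      using A' by (subst emeasure_distr) (auto intro!: arg_cong[where f="emeasure (PiM I M)"] simp: space_PiM PiE_iff extensional_def)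
    also have "\<dots> = (\<Prod>i\<in>I. emeasure (M i) (T i -` A i \<inter> space (M i)))"
      using A I by (intro M.emeasure_PiM) (auto intro!: measurable_sets[OF T])
    also have "\<dots> = (\<Prod>i\<in>I. emeasure (?D i) (A i))"
      unfolding eq[symmetric] using A by (intro prod.cong) (auto simp: emeasure_distr)
    finally show "emeasure (distr (PiM I M) (PiM I M) (\<lambda>x. \<lambda>i\<in>I. T i (x i))) (Pi\<^sub>E I A)
      = (\<Prod>i\<in>I. emeasure (?D i) (A i))" .
  qed (simp add: S)
  moreover have "density (PiM I M) (\<lambda>x. \<Prod>i\<in>I. r i (x i)) = PiM I ?D"
  proof (rule D.PiM_eqI[OF I])
    fix A assume "\<And>i. i \<in> I \<Longrightarrow> A i \<in> sets (?D i)"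
    then have A: "\<And>i. i \<in> I \<Longrightarrow> A i \<in> sets (M i)" by simp
    then have A': "Pi\<^sub>E I A \<in> sets (PiM I M)" using I by (intro sets_PiM_I_finite)
    have "emeasure (density (PiM I M) (\<lambda>x. \<Prod>i\<in>I. r i (x i))) (Pi\<^sub>E I A)
      = (\<integral>\<^sup>+x. (\<Prod>i\<in>I. r i (x i)) * indicator (Pi\<^sub>E I A) x \<partial>PiM I M)"
      using A' I by (subst emeasure_density) auto
    also have "\<dots> = (\<integral>\<^sup>+x. (\<Prod>i\<in>I. r i (x i) * indicator (A i) (x i)) \<partial>PiM I M)"
      using I by (intro nn_integral_cong)
        (auto simp: prod.distrib space_PiM PiE_iff indicator_def)
    also have "\<dots> = (\<Prod>i\<in>I. emeasure (?D i) (A i))"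
      using A by (subst M.product_nn_integral_prod[OF I]) (auto simp: emeasure_density intro!: prod.cong)
    finally show "emeasure (density (PiM I M) (\<lambda>x. \<Prod>i\<in>I. r i (x i))) (Pi\<^sub>E I A)
      = (\<Prod>i\<in>I. emeasure (?D i) (A i))" .
  qed (simp add: S)
  ultimately show ?thesis by simp
qed

text \<open>In each coordinate the image is normal with mean \<open>c i\<close> and deviation
  \<open>\<sigma>\<close>; the quotient of the two Lebesgue densities is its density relative to the
  original Gaussian.\<close>

lemma distr_std_gaussian_affine:
  assumes \<sigma>: "\<sigma> > 0"
  shows "distr (std_gaussian d) (std_gaussian d) (\<lambda>x. \<lambda>i\<in>{..<d}. c i + \<sigma> * x i) =
    density (std_gaussian d)
      (\<lambda>x. ennreal (\<Prod>i<d. normal_density (c i) \<sigma> (x i) / std_normal_density (x i)))"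
proof -
  let ?N = "density lborel (\<lambda>x. ennreal (std_normal_density x))"
  interpret N: prob_space ?N by (rule prob_space_normal_density) simp
  have 1: "distr ?N ?N (\<lambda>x. m + \<sigma> * x)
      = density ?N (\<lambda>x. ennreal (normal_density m \<sigma> x / std_normal_density x))" (is "?L = ?R") for m
  proof -
    have "distributed ?N lborel (\<lambda>x. x) std_normal_density"
      by (auto simp: distributed_def emeasure_distr intro!: measure_eqI)
    from N.normal_density_affine[OF this, of \<sigma> m] \<sigma>
    have "distr ?N lborel (\<lambda>x. m + \<sigma> * x) = density lborel (normal_density m \<sigma>)"
      by (simp add: distributed_def)
    moreover have "distr ?N lborel (\<lambda>x. m + \<sigma> * x) = ?L"
      by (intro distr_cong) auto
    moreover have "?R = density lborel (normal_density m \<sigma>)"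
      using normal_density_pos[of 1 0]
      by (subst density_density_eq)
        (auto simp: ennreal_mult'[symmetric] less_imp_neq[symmetric])
    ultimately show ?thesis by simp
  qed
  show ?thesis
    unfolding std_gaussian_eq_PiM
    by (subst distr_PiM_density[where r="\<lambda>i x. ennreal (normal_density (c i) \<sigma> x / std_normal_density x)"])
      (auto simp: 1 N.prob_space_axioms prod_ennreal intro!: divide_nonneg_nonneg)
qed

lemma normal_density_ratio_shift:
  "normal_density m 1 x / std_normal_density x = exp (m * x - m\<^sup>2 / 2)"
  by (simp add: normal_density_def exp_diff[symmetric] power2_diff field_simps)

lemma sets_std_gaussian [measurable_cong]: "sets (std_gaussian d) = sets (euclid d)"
  using std_gaussian_prob_measures[of d] by (simp add: prob_measures_def)

lemma space_std_gaussian: "space (std_gaussian d) = space (euclid d)"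
  by (intro sets_eq_imp_space_eq sets_std_gaussian)

lemma prob_space_std_gaussian: "prob_space (std_gaussian d)"
  using std_gaussian_prob_measures[of d] by (simp add: prob_measures_def)

lemma measurable_euclid_component [measurable (raw)]:
  "i < d \<Longrightarrow> (\<lambda>x. x i) \<in> borel_measurable (euclid d)"
  unfolding euclid_def by measurable

lemma measurable_euclid_restrict [measurable]:
  "(\<And>i. i < d \<Longrightarrow> (\<lambda>x. F x i) \<in> borel_measurable M) \<Longrightarrow> (\<lambda>x. \<lambda>i\<in>{..<d}. F x i) \<in> M \<rightarrow>\<^sub>M euclid d"
  unfolding euclid_def by (intro measurable_restrict) auto

lemma measurable_dot [measurable]: "dot d a \<in> borel_measurable (euclid d)"
  unfolding dot_def[abs_def] by (intro borel_measurable_sum borel_measurable_times) auto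

text \<open>The Cameron-Martin formula in finite dimension. It turns the exponential weights of the
  normal flow into translations.\<close>

lemma nn_integral_std_gaussian_shift:
  assumes F [measurable]: "F \<in> borel_measurable (euclid d)"
  shows "(\<integral>\<^sup>+x. F x * ennreal (exp (dot d c x - dot d c c / 2)) \<partial>std_gaussian d)
    = (\<integral>\<^sup>+x. F (\<lambda>i\<in>{..<d}. c i + x i) \<partial>std_gaussian d)"
proof -
  have "(\<integral>\<^sup>+x. F (\<lambda>i\<in>{..<d}. c i + x i) \<partial>std_gaussian d)
      = (\<integral>\<^sup>+x. F x \<partial>distr (std_gaussian d) (std_gaussian d) (\<lambda>x. \<lambda>i\<in>{..<d}. c i + 1 * x i))"
    by (subst nn_integral_distr) auto
  also have "\<dots> = (\<integral>\<^sup>+x. ennreal (\<Prod>i<d. exp (c i * x i - (c i)\<^sup>2 / 2)) * F x \<partial>std_gaussian d)"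
    by (subst distr_std_gaussian_affine, simp, subst nn_integral_density)
       (auto simp: normal_density_ratio_shift intro!: measurable_compose[OF _ measurable_ennreal])
  also have "\<dots> = (\<integral>\<^sup>+x. F x * ennreal (exp (dot d c x - dot d c c / 2)) \<partial>std_gaussian d)"
    by (auto simp: exp_sum[symmetric] dot_def sum_subtractf sum_divide_distrib power2_eq_square mult.commute)
  finally show ?thesis ..
qed

section \<open>Dilations of the Gaussian: chi-square and L1 distance to the original\<close>

definition dilation_density :: "nat \<Rightarrow> real \<Rightarrow> (nat \<Rightarrow> real) \<Rightarrow> real" where
  "dilation_density d \<sigma> x = (\<Prod>i<d. normal_density 0 \<sigma> (x i) / std_normal_density (x i))"

lemma dilation_density_nonneg: "0 \<le> dilation_density d \<sigma> x"
  unfolding dilation_density_def by (intro prod_nonneg divide_nonneg_nonneg) auto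

lemma measurable_dilation_density [measurable]: "dilation_density d \<sigma> \<in> borel_measurable (euclid d)"
  unfolding dilation_density_def[abs_def] by (intro borel_measurable_prod borel_measurable_divide) auto

lemma distr_std_gaussian_dilation:
  assumes \<sigma>: "\<sigma> > 0"
  shows "distr (std_gaussian d) (std_gaussian d) (\<lambda>x. \<lambda>i\<in>{..<d}. \<sigma> * x i) =
    density (std_gaussian d) (\<lambda>x. ennreal (dilation_density d \<sigma> x))"
  using distr_std_gaussian_affine[OF \<sigma>, of d "\<lambda>_. 0"] by (simp add: dilation_density_def)

text \<open>Twice the exponent for deviation \<open>\<sigma>\<close> minus the standard one is the
  exponent of a centred normal law of variance \<open>\<sigma>^2 / (2 - \<sigma>^2)\<close>; this
  variance is positive because \<open>\<sigma>^2 < 2\<close>. The constant comes from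
  \<open>\<sigma>^2 * (2 - \<sigma>^2) = 1 - (\<sigma>^2 - 1)^2\<close>.\<close>

lemma normal_density_sq_ratio:
  assumes "\<sigma> > 0" "\<sigma>\<^sup>2 < 2"
  shows "(normal_density 0 \<sigma> x)\<^sup>2 / std_normal_density x
    = 1 / sqrt (1 - (\<sigma>\<^sup>2 - 1)\<^sup>2) * normal_density 0 (\<sigma> / sqrt (2 - \<sigma>\<^sup>2)) x"
proof -
  define v where "v = 2 - \<sigma>\<^sup>2"
  have v: "v > 0" "\<sigma>\<^sup>2 = 2 - v" using assms by (auto simp: v_def)
  have e: "exp (- x\<^sup>2 / (2 * \<sigma>\<^sup>2)) ^ 2 / exp (- x\<^sup>2 / 2) = exp (- x\<^sup>2 / (2 * (\<sigma>\<^sup>2 / v)))"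
  proof -
    have "- x\<^sup>2 / (2 * (\<sigma>\<^sup>2 / v)) = 2 * (- x\<^sup>2 / (2 * \<sigma>\<^sup>2)) - (- x\<^sup>2 / 2)"
      using assms by (simp add: v_def field_simps)
    then show ?thesis by (simp only: exp_diff exp_double)
  qed
  have s: "1 - (\<sigma>\<^sup>2 - 1)\<^sup>2 = \<sigma>\<^sup>2 * v" by (simp add: v_def power2_eq_square algebra_simps)
  have "(normal_density 0 \<sigma> x)\<^sup>2 / std_normal_density x
     = ((1 / sqrt (2 * pi * \<sigma>\<^sup>2))\<^sup>2 / (1 / sqrt (2 * pi))) * (exp (- x\<^sup>2 / (2 * \<sigma>\<^sup>2)) ^ 2 / exp (- x\<^sup>2 / 2))"
    by (simp add: normal_density_def power_mult_distrib power_divide)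
  also have "(1 / sqrt (2 * pi * \<sigma>\<^sup>2))\<^sup>2 / (1 / sqrt (2 * pi)) =
      1 / sqrt (\<sigma>\<^sup>2 * v) * (1 / sqrt (2 * pi * (\<sigma>\<^sup>2 / v)))"
  proof -
    have "sqrt (\<sigma>\<^sup>2 * v) * sqrt (2 * pi * (\<sigma>\<^sup>2 / v)) = sqrt (2 * pi) * \<sigma>\<^sup>2"
      using assms(1) v(1) by (simp add: real_sqrt_mult real_sqrt_divide power2_eq_square)
    moreover have "(1 / sqrt (2 * pi * \<sigma>\<^sup>2))\<^sup>2 / (1 / sqrt (2 * pi)) = 1 / (sqrt (2 * pi) * \<sigma>\<^sup>2)"
      using assms by (simp add: real_sqrt_mult power2_eq_square field_simps)
    ultimately show ?thesis by (simp add: field_simps)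
  qed
  finally show ?thesis
    unfolding e s v_def[symmetric] using v(1) by (simp add: normal_density_def power_divide)
qed

text \<open>This second moment is one plus the chi-square divergence of the dilated law from the
  Gaussian. By independence it is the \<open>d\<close>-th power of its one-dimensional
  value.\<close>

lemma nn_integral_dilation_density_sq:
  assumes \<sigma>: "\<sigma> > 0" "\<sigma>\<^sup>2 < 2"
  shows "(\<integral>\<^sup>+x. ennreal ((dilation_density d \<sigma> x)\<^sup>2) \<partial>std_gaussian d)
    = ennreal ((1 / sqrt (1 - (\<sigma>\<^sup>2 - 1)\<^sup>2)) ^ d)"
proof -
  let ?N = "density lborel (\<lambda>x. ennreal (std_normal_density x))"
  let ?K = "1 / sqrt (1 - (\<sigma>\<^sup>2 - 1)\<^sup>2)"
  interpret N: prob_space ?N by (rule prob_space_normal_density) simp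
  interpret P: product_prob_space "\<lambda>_::nat. ?N"
    by (intro product_prob_spaceI N.prob_space_axioms)
  have K: "0 \<le> ?K"
    using assms by (auto simp: power2_eq_square algebra_simps intro!: mult_mono)
  have 1: "(\<integral>\<^sup>+x. ennreal ((normal_density 0 \<sigma> x / std_normal_density x)\<^sup>2) \<partial>?N) = ennreal ?K"
  proof -
    have "(\<integral>\<^sup>+x. ennreal ((normal_density 0 \<sigma> x / std_normal_density x)\<^sup>2) \<partial>?N)
      = (\<integral>\<^sup>+x. ennreal (std_normal_density x) * ennreal ((normal_density 0 \<sigma> x / std_normal_density x)\<^sup>2) \<partial>lborel)"
      by (intro nn_integral_density) auto
    also have "\<dots> = (\<integral>\<^sup>+x. ennreal (?K * normal_density 0 (\<sigma> / sqrt (2 - \<sigma>\<^sup>2)) x) \<partial>lborel)"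
    proof (intro nn_integral_cong)
      fix x
      have "std_normal_density x \<noteq> 0" using normal_density_pos[of 1 0 x] by simp
      then have "std_normal_density x * (normal_density 0 \<sigma> x / std_normal_density x)\<^sup>2
        = (normal_density 0 \<sigma> x)\<^sup>2 / std_normal_density x"
        by (simp add: power2_eq_square field_simps)
      then show "ennreal (std_normal_density x) * ennreal ((normal_density 0 \<sigma> x / std_normal_density x)\<^sup>2)
         = ennreal (?K * normal_density 0 (\<sigma> / sqrt (2 - \<sigma>\<^sup>2)) x)"
        using normal_density_sq_ratio[OF \<sigma>, of x] by (simp add: ennreal_mult'[symmetric])
    qed
    also have "\<dots> = ennreal ?K * (\<integral>\<^sup>+x. ennreal (normal_density 0 (\<sigma> / sqrt (2 - \<sigma>\<^sup>2)) x) \<partial>lborel)"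
      by (simp only: ennreal_mult'[OF K]) (rule nn_integral_cmult, simp)
    also have "(\<integral>\<^sup>+x. ennreal (normal_density 0 (\<sigma> / sqrt (2 - \<sigma>\<^sup>2)) x) \<partial>lborel) = 1"
      using assms by (subst nn_integral_eq_integral) (auto simp: integral_normal_density)
    finally show ?thesis by simp
  qed
  have "(\<integral>\<^sup>+x. ennreal ((dilation_density d \<sigma> x)\<^sup>2) \<partial>std_gaussian d)
    = (\<integral>\<^sup>+x. (\<Prod>i<d. ennreal ((normal_density 0 \<sigma> (x i) / std_normal_density (x i))\<^sup>2)) \<partial>PiM {..<d} (\<lambda>_. ?N))"
    unfolding std_gaussian_eq_PiM dilation_density_def
    by (intro nn_integral_cong) (simp only: prod_power_distrib[symmetric] prod_ennreal zero_le_power2)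
  also have "\<dots> = (\<Prod>i<d. ennreal ?K)"
    by (subst P.product_nn_integral_prod) (auto simp: 1)
  finally show ?thesis using K by (simp add: ennreal_power)
qed

lemma integrable_dot_std_gaussian: "integrable (std_gaussian d) (dot d a)"
proof -
  let ?N = "density lborel (\<lambda>x. ennreal (std_normal_density x))"
  have N: "prob_space ?N" by (rule prob_space_normal_density) simp
  have N1: "integrable ?N (\<lambda>x. x)"
    using integrable_normal_moment_nz_1[of 1 0] by (subst integrable_density) auto
  have "integrable (std_gaussian d) (\<lambda>x. x i)" if i: "i < d" for i
  proof -
    have "integrable (distr (PiM {..<d} (\<lambda>_. ?N)) ?N (\<lambda>x. x i)) (\<lambda>x. x)"
      using N1 N i by (subst distr_PiM_component) auto
    then show ?thesis
      unfolding std_gaussian_eq_PiM using i by (subst (asm) integrable_distr_eq) auto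
  qed
  then show ?thesis
    unfolding dot_def[abs_def] by (intro Bochner_Integration.integrable_sum integrable_mult_right) auto
qed

text \<open>In the range \<open>small\<close> the chi-square divergence is of order
  \<open>d * (\<sigma>^2 - 1)^2\<close>, and the L1 distance is controlled by its square root. This
  is the source of the factor \<open>sqrt d\<close>.\<close>

lemma dilation_density_L1:
  assumes \<sigma>: "1 < \<sigma>" and d: "d \<ge> 1" and small: "real d * (\<sigma>\<^sup>2 - 1)\<^sup>2 \<le> 1 / 2"
  shows "integrable (std_gaussian d) (dilation_density d \<sigma>)"
    and "(\<integral>x. \<bar>dilation_density d \<sigma> x - 1\<bar> \<partial>std_gaussian d) \<le> 2 * (\<sigma>\<^sup>2 - 1) * sqrt (real d)"
proof -
  let ?G = "std_gaussian d" and ?\<rho> = "dilation_density d \<sigma>"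
  define q where "q = \<sigma>\<^sup>2 - 1"
  interpret prob_space ?G by (rule prob_space_std_gaussian)
  have q: "q > 0" using \<sigma> by (simp add: q_def)
  have dq: "real d * q\<^sup>2 \<le> 1 / 2" using small by (simp add: q_def)
  have q2: "q\<^sup>2 \<le> 1 / 2" using d mult_right_mono[of 1 "real d" "q\<^sup>2"] dq by simp
  then have q1: "q < 1" using one_le_power[of q 2] by linarith
  have s2: "\<sigma>\<^sup>2 < 2" using q1 by (simp add: q_def)
  have pd: "prob_space (density ?G (\<lambda>x. ennreal (?\<rho> x)))"
    using \<sigma> unfolding distr_std_gaussian_dilation[of \<sigma> d, symmetric, OF less_trans[OF zero_less_one \<sigma>]]
    by (intro prob_space_distr) simp
  have E1: "(\<integral>\<^sup>+x. ennreal (?\<rho> x) \<partial>?G) = 1"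
  proof -
    have "(\<integral>\<^sup>+x. ennreal (?\<rho> x) \<partial>?G) = emeasure (density ?G (\<lambda>x. ennreal (?\<rho> x))) (space ?G)"
      by (subst emeasure_density) (auto intro!: nn_integral_cong)
    then show ?thesis using prob_space.emeasure_space_1[OF pd] by simp
  qed
  show int: "integrable ?G ?\<rho>"
    using E1 by (intro integrableI_nn_integral_finite[where x=1]) (auto simp: dilation_density_nonneg)
  have I1: "(\<integral>x. ?\<rho> x \<partial>?G) = 1"
    using E1 by (subst integral_eq_nn_integral) (auto simp: dilation_density_nonneg)
  define K where "K = (1 / sqrt (1 - q\<^sup>2)) ^ d"
  have K0: "K \<ge> 0" using q2 by (simp add: K_def)
  have E2: "(\<integral>\<^sup>+x. ennreal ((?\<rho> x)\<^sup>2) \<partial>?G) = ennreal K"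
    using nn_integral_dilation_density_sq[of \<sigma> d] \<sigma> s2 by (simp add: K_def q_def)
  have int2: "integrable ?G (\<lambda>x. (?\<rho> x)\<^sup>2)"
    using E2 K0 by (intro integrableI_nn_integral_finite[where x=K]) auto
  have I2: "(\<integral>x. (?\<rho> x)\<^sup>2 \<partial>?G) = K"
    using E2 K0 by (subst integral_eq_nn_integral) auto
  \<comment> \<open>The square root dominates the identity on [0, 1], Bernoulli's inequality handles
    the \<open>d\<close>-th power, and \<open>1 / (1 - y) \<le> 1 + 2 * y\<close> for
    \<open>0 \<le> y \<le> 1 / 2\<close>.\<close>
  have Kle: "K \<le> 1 + 2 * (real d * q\<^sup>2)"
  proof -
    let ?y = "real d * q\<^sup>2"
    have 0: "0 < 1 - q\<^sup>2" "1 - q\<^sup>2 \<le> 1" using q2 by auto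
    have "1 - q\<^sup>2 \<le> sqrt (1 - q\<^sup>2)"
      using 0 by (intro real_le_rsqrt) (auto simp: power2_eq_square mult_le_cancel_right1)
    then have "K \<le> (1 / (1 - q\<^sup>2)) ^ d"
      unfolding K_def using 0 by (intro power_mono divide_left_mono) auto
    also have "\<dots> = 1 / (1 - q\<^sup>2) ^ d" by (simp add: power_divide)
    also have "\<dots> \<le> 1 / (1 - ?y)"
      using 0 dq Bernoulli_inequality[of "- (q\<^sup>2)" d] by (intro divide_left_mono) (auto intro!: mult_pos_pos)
    also have "\<dots> \<le> 1 + 2 * ?y"
    proof -
      have "0 \<le> ?y * (1 - 2 * ?y)" using dq by (intro mult_nonneg_nonneg) auto
      then have "1 \<le> (1 + 2 * ?y) * (1 - ?y)" by (simp add: algebra_simps)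
      then show ?thesis using dq by (simp add: divide_le_eq)
    qed
    finally show ?thesis .
  qed
  define c where "c = q * sqrt (real d)"
  have c: "c > 0" "c\<^sup>2 = real d * q\<^sup>2" using q d by (auto simp: c_def power_mult_distrib)
  have int3: "integrable ?G (\<lambda>x. (?\<rho> x - 1)\<^sup>2)"
    using int int2 by (simp add: power2_diff)
  have I3: "(\<integral>x. (?\<rho> x - 1)\<^sup>2 \<partial>?G) = K - 1"
    using int int2 by (simp add: power2_diff I1 I2 prob_space)
  \<comment> \<open>A weighted arithmetic-geometric mean inequality in place of Cauchy-Schwarz.
    Since the second moment of \<open>?\<rho> - 1\<close> is at most \<open>2 * c^2\<close>, both
    terms have order \<open>c\<close> after integration.\<close>
  have pw: "\<bar>y\<bar> \<le> (y\<^sup>2 / c + c) / 2" for y :: real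
  proof -
    have "2 * (\<bar>y\<bar> * c) \<le> \<bar>y\<bar>\<^sup>2 + c\<^sup>2" using sum_squares_bound[of "\<bar>y\<bar>" c] by simp
    then show ?thesis using c(1) by (simp add: field_simps power2_eq_square)
  qed
  have "(\<integral>x. \<bar>?\<rho> x - 1\<bar> \<partial>?G) \<le> (\<integral>x. ((?\<rho> x - 1)\<^sup>2 / c + c) / 2 \<partial>?G)"
    using int int3 pw by (intro integral_mono) auto
  also have "\<dots> = ((K - 1) / c + c) / 2"
    using int3 by (simp add: I3 prob_space)
  also have "\<dots> \<le> (2 * c\<^sup>2 / c + c) / 2"
    using Kle c by (intro divide_right_mono add_right_mono) auto
  also have "\<dots> \<le> 2 * c" using c(1) by (simp add: power2_eq_square)
  finally show "(\<integral>x. \<bar>?\<rho> x - 1\<bar> \<partial>?G) \<le> 2 * (\<sigma>\<^sup>2 - 1) * sqrt (real d)"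
    by (simp add: c_def q_def algebra_simps)
qed

text \<open>By change of variables the difference is the expectation of
  \<open>(?\<rho> - 1) * H\<close>, hence at most the bound on \<open>H\<close> times the L1
  distance.\<close>

lemma integral_dilation_le:
  assumes \<sigma>: "1 < \<sigma>" and d: "d \<ge> 1" and small: "real d * (\<sigma>\<^sup>2 - 1)\<^sup>2 \<le> 1 / 2"
    and H [measurable]: "H \<in> borel_measurable (euclid d)" and B: "\<And>x. \<bar>H x\<bar> \<le> B"
  shows "(\<integral>x. H (\<lambda>i\<in>{..<d}. \<sigma> * x i) \<partial>std_gaussian d) - (\<integral>x. H x \<partial>std_gaussian d)
    \<le> B * (2 * (\<sigma>\<^sup>2 - 1) * sqrt (real d))"
proof -
  let ?G = "std_gaussian d" and ?\<rho> = "dilation_density d \<sigma>"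
  interpret prob_space ?G by (rule prob_space_std_gaussian)
  note L1 = dilation_density_L1[OF \<sigma> d small]
  have B0: "0 \<le> B" using B[of undefined] by linarith
  have iH: "integrable ?G H" using B by (intro integrable_const_bound[where B=B]) auto
  have i\<rho>H: "integrable ?G (\<lambda>x. ?\<rho> x * H x)"
  proof (rule Bochner_Integration.integrable_bound)
    show "integrable ?G (\<lambda>x. B * ?\<rho> x)" using L1(1) by simp
    show "AE x in ?G. norm (?\<rho> x * H x) \<le> norm (B * ?\<rho> x)"
    proof (rule AE_I2)
      fix x show "norm (?\<rho> x * H x) \<le> norm (B * ?\<rho> x)"
        using mult_left_mono[OF B dilation_density_nonneg] B0
        by (simp add: abs_mult dilation_density_nonneg mult.commute)
    qed
  qed simp
  have "(\<integral>x. H (\<lambda>i\<in>{..<d}. \<sigma> * x i) \<partial>?G) = (\<integral>x. H x \<partial>distr ?G ?G (\<lambda>x. \<lambda>i\<in>{..<d}. \<sigma> * x i))"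
    by (subst integral_distr) auto
  also have "\<dots> = (\<integral>x. ?\<rho> x * H x \<partial>?G)"
    using \<sigma> by (subst distr_std_gaussian_dilation, simp, subst integral_density)
      (auto simp: dilation_density_nonneg)
  finally have "(\<integral>x. H (\<lambda>i\<in>{..<d}. \<sigma> * x i) \<partial>?G) - (\<integral>x. H x \<partial>?G) = (\<integral>x. (?\<rho> x - 1) * H x \<partial>?G)"
    using iH i\<rho>H by (simp add: left_diff_distrib)
  also have "\<dots> \<le> (\<integral>x. B * \<bar>?\<rho> x - 1\<bar> \<partial>?G)"
  proof (rule integral_mono)
    show "integrable ?G (\<lambda>x. (?\<rho> x - 1) * H x)" using iH i\<rho>H by (simp add: left_diff_distrib)
    show "integrable ?G (\<lambda>x. B * \<bar>?\<rho> x - 1\<bar>)" using L1(1) by simp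
    fix x
    have "(?\<rho> x - 1) * H x \<le> \<bar>?\<rho> x - 1\<bar> * \<bar>H x\<bar>" by (simp add: abs_mult[symmetric])
    also have "\<dots> \<le> B * \<bar>?\<rho> x - 1\<bar>" using B by (simp add: mult.commute mult_right_mono)
    finally show "(?\<rho> x - 1) * H x \<le> B * \<bar>?\<rho> x - 1\<bar>" .
  qed
  also have "\<dots> = B * (\<integral>x. \<bar>?\<rho> x - 1\<bar> \<partial>?G)" by simp
  also have "\<dots> \<le> B * (2 * (\<sigma>\<^sup>2 - 1) * sqrt (real d))" by (intro mult_left_mono L1(2) B0)
  finally show ?thesis .
qed

section \<open>The Gaussian measure of polyhedral shells\<close>

locale polyhedral =
  fixes d :: nat and J :: "nat set" and a :: "nat \<Rightarrow> nat \<Rightarrow> real" and b :: "nat \<Rightarrow> real"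
  assumes d: "d \<ge> 1" and J: "finite J" "J \<noteq> {}" and unit: "\<And>j. j \<in> J \<Longrightarrow> dot d (a j) (a j) = 1"
begin

definition g :: "nat \<Rightarrow> (nat \<Rightarrow> real) \<Rightarrow> real" where
  "g j x = dot d (a j) x - b j"

definition f :: "(nat \<Rightarrow> real) \<Rightarrow> real" where
  "f x = Max ((\<lambda>j. g j x) ` J)"

text \<open>Ties on common faces go to the least index, so that the cells
  \<open>{x. sel x = j}\<close> partition the whole space.\<close>

definition sel :: "(nat \<Rightarrow> real) \<Rightarrow> nat" where
  "sel x = (LEAST j. j \<in> J \<and> g j x = f x)"

text \<open>Where \<open>f\<close> is differentiable, this is the derivative of \<open>f\<close> at
  \<open>x\<close> in the direction \<open>x\<close>.\<close>

definition u :: "(nat \<Rightarrow> real) \<Rightarrow> real" where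
  "u x = dot d (a (sel x)) x"

lemma g_le_f: "j \<in> J \<Longrightarrow> g j x \<le> f x"
  unfolding f_def using J by auto

lemma f_le_iff: "f x \<le> c \<longleftrightarrow> (\<forall>j\<in>J. g j x \<le> c)"
  unfolding f_def using J by simp

lemma sel: "sel x \<in> J" "g (sel x) x = f x"
proof -
  have "f x \<in> (\<lambda>j. g j x) ` J" unfolding f_def using J by (intro Max_in) auto
  then have "\<exists>j. j \<in> J \<and> g j x = f x" by force
  from LeastI_ex[OF this] show "sel x \<in> J" "g (sel x) x = f x" by (auto simp: sel_def)
qed

lemma measurable_g [measurable]: "g j \<in> borel_measurable (euclid d)"
  unfolding g_def[abs_def] by measurable

lemma measurable_f [measurable]: "f \<in> borel_measurable (euclid d)"
  unfolding f_def[abs_def] using J by (intro borel_measurable_Max) auto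

lemma measurable_sel [measurable]: "sel \<in> euclid d \<rightarrow>\<^sub>M count_space UNIV"
proof -
  have [measurable]: "Measurable.pred (euclid d) (\<lambda>x. g j x = f x)" for j
    unfolding pred_def by (rule borel_measurable_eq) auto
  show ?thesis unfolding sel_def[abs_def] by measurable
qed

lemma measurable_u [measurable]: "u \<in> borel_measurable (euclid d)"
  unfolding u_def[abs_def]
  by (rule measurable_compose_countable[where f="\<lambda>j x. dot d (a j) x"]) auto

section \<open>Translation along the normal of the active face\<close>

lemma dot_unit_le_1:
  assumes "j \<in> J" "k \<in> J"
  shows "dot d (a j) (a k) \<le> 1"
proof -
  have "0 \<le> (\<Sum>i<d. (a j i - a k i)\<^sup>2)" by (intro sum_nonneg) auto
  also have "\<dots> = dot d (a j) (a j) + dot d (a k) (a k) - 2 * dot d (a j) (a k)"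
    by (simp add: dot_def power2_eq_square algebra_simps sum.distrib sum_subtractf sum_distrib_left)
  finally show ?thesis using assms unit by simp
qed

text \<open>Moving by \<open>t\<close> along the active unit normal raises the active function by
  exactly \<open>t\<close> and every other one by at most \<open>t\<close>. So the active function
  stays maximal, and an index that attains the maximum afterwards attained it before, which
  preserves the least such index.\<close>

lemma flow:
  assumes t: "t \<ge> 0"
  shows "f (\<lambda>i\<in>{..<d}. t * a (sel x) i + x i) = f x + t"
    and "sel (\<lambda>i\<in>{..<d}. t * a (sel x) i + x i) = sel x"
proof -
  let ?y = "\<lambda>i\<in>{..<d}. t * a (sel x) i + x i"
  have gy: "g k ?y = g k x + t * dot d (a k) (a (sel x))" for k
    by (simp add: g_def dot_def algebra_simps sum.distrib sum_distrib_left)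
  have le: "g k ?y \<le> g k x + t" if "k \<in> J" for k
    using mult_left_mono[OF dot_unit_le_1[OF that sel(1)] t] by (simp add: gy)
  have eq: "g (sel x) ?y = f x + t" by (simp add: gy unit[OF sel(1)] sel)
  show fy: "f ?y = f x + t"
  proof (rule antisym)
    show "f ?y \<le> f x + t" unfolding f_le_iff using le g_le_f[of _ x] by force
    show "f x + t \<le> f ?y" using g_le_f[OF sel(1), of x ?y] eq by simp
  qed
  show "sel ?y = sel x"
    unfolding sel_def[of ?y]
  proof (rule Least_equality)
    show "sel x \<in> J \<and> g (sel x) ?y = f ?y" using eq fy sel(1) by simp
    fix k assume k: "k \<in> J \<and> g k ?y = f ?y"
    then have "g k x = f x" using le[of k] g_le_f[of k x] fy by simp
    then show "sel x \<le> k" unfolding sel_def using k by (intro Least_le) simp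
  qed
qed

text \<open>On each cell the normal is constant, so Cameron-Martin rewrites the weighted integral as
  one over points translated backwards by \<open>t\<close>. By \<open>flow\<close>, a point whose
  backward translate is in a cell lies in that cell itself, and \<open>f\<close> differs by
  \<open>t\<close> between the two.\<close>

lemma nn_integral_normal_flow_le:
  assumes t: "t \<ge> 0" and k [measurable]: "k \<in> borel_measurable borel"
  shows "(\<integral>\<^sup>+x. k (f x) * ennreal (exp (- t * u x - t\<^sup>2 / 2)) \<partial>std_gaussian d)
    \<le> (\<integral>\<^sup>+x. k (f x - t) \<partial>std_gaussian d)"
proof -
  let ?G = "std_gaussian d"
  let ?y = "\<lambda>j x. \<lambda>i\<in>{..<d}. - t * a j i + x i"
  have part: "F x = (\<Sum>j\<in>J. F x * indicator {x. sel x = j} x)" for F :: "(nat \<Rightarrow> real) \<Rightarrow> ennreal" and x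
  proof -
    have "(\<Sum>j\<in>J. F x * indicator {x. sel x = j} x) = (\<Sum>j\<in>J. if sel x = j then F x else 0)"
      by (intro sum.cong) (auto simp: indicator_def)
    then show ?thesis using J sel(1) by simp
  qed
  have split: "(\<integral>\<^sup>+x. F x \<partial>?G) = (\<Sum>j\<in>J. \<integral>\<^sup>+x. F x * indicator {x. sel x = j} x \<partial>?G)"
    if [measurable]: "F \<in> borel_measurable (euclid d)" for F
  proof -
    have "(\<integral>\<^sup>+x. F x \<partial>?G) = (\<integral>\<^sup>+x. (\<Sum>j\<in>J. F x * indicator {x. sel x = j} x) \<partial>?G)"
      by (intro nn_integral_cong part)
    also have "\<dots> = (\<Sum>j\<in>J. \<integral>\<^sup>+x. F x * indicator {x. sel x = j} x \<partial>?G)"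
      by (rule nn_integral_sum) measurable
    finally show ?thesis .
  qed
  have "(\<integral>\<^sup>+x. k (f x) * ennreal (exp (- t * u x - t\<^sup>2 / 2)) \<partial>?G)
    = (\<Sum>j\<in>J. \<integral>\<^sup>+x. k (f x) * ennreal (exp (- t * u x - t\<^sup>2 / 2)) * indicator {x. sel x = j} x \<partial>?G)"
    by (rule split) measurable
  also have "\<dots> \<le> (\<Sum>j\<in>J. \<integral>\<^sup>+x. k (f x - t) * indicator {x. sel x = j} x \<partial>?G)"
  proof (rule sum_mono)
    fix j assume j: "j \<in> J"
    let ?c = "\<lambda>i. - t * a j i"
    have c: "dot d ?c x = - t * dot d (a j) x" for x
      by (simp add: dot_def sum_distrib_left sum_negf algebra_simps)
    have cc: "dot d ?c ?c = t\<^sup>2"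
      using unit[OF j] by (simp add: dot_def power2_eq_square sum_distrib_left[symmetric] algebra_simps)
    have "(\<integral>\<^sup>+x. k (f x) * ennreal (exp (- t * u x - t\<^sup>2 / 2)) * indicator {x. sel x = j} x \<partial>?G)
      = (\<integral>\<^sup>+x. (k (f x) * indicator {x. sel x = j} x) * ennreal (exp (dot d ?c x - dot d ?c ?c / 2)) \<partial>?G)"
      unfolding cc c by (intro nn_integral_cong) (auto simp: u_def indicator_def)
    also have "\<dots> = (\<integral>\<^sup>+x. k (f (?y j x)) * indicator {x. sel x = j} (?y j x) \<partial>?G)"
      by (rule nn_integral_std_gaussian_shift) measurable
    also have "\<dots> \<le> (\<integral>\<^sup>+x. k (f x - t) * indicator {x. sel x = j} x \<partial>?G)"
    proof (rule nn_integral_mono)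
      fix x assume "x \<in> space ?G"
      then have x: "x \<in> extensional {..<d}" by (simp add: space_std_gaussian space_euclid PiE_def)
      show "k (f (?y j x)) * indicator {x. sel x = j} (?y j x) \<le> k (f x - t) * indicator {x. sel x = j} x"
      proof (cases "sel (?y j x) = j")
        \<comment> \<open>Here \<open>x\<close> is the end point of the flow started at
          \<open>?y j x\<close>. Points of the cell whose backward translate has left it occur only
          on the right, whence an inequality.\<close>
        case True
        have "(\<lambda>i\<in>{..<d}. t * a j i + ?y j x i) = x" using x by (auto simp: extensional_def)
        then show ?thesis using flow[OF t, of "?y j x"] True by simp
      qed simp
    qed
    finally show "(\<integral>\<^sup>+x. k (f x) * ennreal (exp (- t * u x - t\<^sup>2 / 2)) * indicator {x. sel x = j} x \<partial>?G)
      \<le> (\<integral>\<^sup>+x. k (f x - t) * indicator {x. sel x = j} x \<partial>?G)" .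
  qed
  also have "\<dots> = (\<integral>\<^sup>+x. k (f x - t) \<partial>?G)"
    by (rule split[symmetric]) measurable
  finally show ?thesis .
qed

end

lemma abs_arctan_diff_le: "\<bar>arctan x - arctan y\<bar> \<le> \<bar>x - y\<bar>"
proof -
  have *: "arctan y - arctan x \<le> y - x" if "x \<le> y" for x y :: real
  proof -
    have "x - arctan x \<le> y - arctan y"
    proof (rule DERIV_nonneg_imp_nondecreasing[OF that])
      fix z :: real
      have "((\<lambda>x. x - arctan x) has_real_derivative 1 - inverse (1 + z\<^sup>2)) (at z)"
        by (auto intro!: derivative_eq_intros)
      moreover have "inverse (1 + z\<^sup>2) \<le> 1" by (simp add: inverse_le_1_iff)
      ultimately show "\<exists>D. ((\<lambda>x. x - arctan x) has_real_derivative D) (at z) \<and> 0 \<le> D"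
        by (intro exI[of _ "1 - inverse (1 + z\<^sup>2)"]) auto
    qed
    then show ?thesis by simp
  qed
  show ?thesis
    using *[of x y] *[of y x] arctan_le_iff[of x y] arctan_le_iff[of y x] by linarith
qed

text \<open>On the half interval \<open>[\<tau> / 2, \<tau>]\<close> the integrand is at least a
  fixed multiple of the positive part of \<open>1 - \<tau> * u\<close>: for \<open>u \<ge> 0\<close>
  because \<open>t \<le> \<tau>\<close>, for \<open>u < 0\<close> because the exponential grows when
  \<open>t \<ge> \<tau> / 2\<close>.\<close>

lemma normal_flow_weight_ge:
  fixes \<tau> u :: real
  assumes \<tau>: "0 < \<tau>" "\<tau> \<le> 1"
  shows "ennreal (1 - \<tau> * u) \<le> ennreal (2 * exp (3 / 2) / \<tau>) *
    (\<integral>\<^sup>+t. ennreal (exp (- t * u - t\<^sup>2 / 2)) * indicator {0..\<tau>} t \<partial>lborel)"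
proof -
  \<comment> \<open>The factor \<open>exp (- 3 / 2)\<close> pays for \<open>exp 1\<close> in the
    bound \<open>exp (1 - t * u)\<close> below and for \<open>exp (- 1 / 2)\<close>, a lower bound
    of the Gaussian factor since \<open>t \<le> 1\<close>.\<close>
  define m where "m = exp (- 3 / 2) * max 0 (1 - \<tau> * u)"
  have m0: "m \<ge> 0" by (simp add: m_def)
  have e2: "2 \<le> exp (1::real)" using exp_ge_add_one_self[of 1] by simp
  have m: "m \<le> exp (- t * u - t\<^sup>2 / 2)" if t: "\<tau> / 2 \<le> t" "t \<le> \<tau>" for t
  proof -
    have t0: "0 \<le> t" using t \<tau> by simp
    have t2: "t\<^sup>2 \<le> 1" using t0 t \<tau> by (intro power_le_one) auto
    have "max 0 (1 - \<tau> * u) \<le> exp (1 - t * u)"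
    proof (cases "0 \<le> u")
      case True
      have "1 - \<tau> * u \<le> 1 - t * u" using t True by (simp add: mult_right_mono)
      also have "\<dots> \<le> exp (1 - t * u)" using exp_ge_add_one_self[of "1 - t * u"] by linarith
      finally show ?thesis by simp
    next
      case False
      \<comment> \<open>Only half of the slope \<open>\<tau>\<close> is available at
        \<open>t = \<tau> / 2\<close>; doubling by \<open>2 \<le> exp 1\<close> recovers it.\<close>
      then have "- \<tau> * u / 2 \<le> - t * u" using mult_right_mono_neg[of "\<tau> / 2" t u] t by simp
      then have "1 + - \<tau> * u / 2 \<le> exp (- t * u)"
        using exp_ge_add_one_self[of "- t * u"] by linarith
      moreover have "0 \<le> - \<tau> * u / 2" using False \<tau> by (simp add: mult_nonneg_nonpos)
      ultimately have "2 * (1 + - \<tau> * u / 2) \<le> exp 1 * exp (- t * u)"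
        using e2 by (intro mult_mono) auto
      then show ?thesis by (simp add: exp_add[symmetric])
    qed
    then have "m \<le> exp (- 3 / 2) * exp (1 - t * u)" unfolding m_def by (intro mult_left_mono) auto
    also have "\<dots> \<le> exp (- t * u - t\<^sup>2 / 2)" using t2 by (simp add: exp_add[symmetric])
    finally show ?thesis .
  qed
  have "ennreal (m * (\<tau> / 2)) = (\<integral>\<^sup>+t. ennreal m * indicator {\<tau>/2..\<tau>} t \<partial>lborel)"
    using \<tau> ennreal_mult'[OF m0, of "\<tau> / 2"] by (simp add: nn_integral_cmult)
  also have "\<dots> \<le> (\<integral>\<^sup>+t. ennreal (exp (- t * u - t\<^sup>2 / 2)) * indicator {0..\<tau>} t \<partial>lborel)"
    using m \<tau> by (intro nn_integral_mono) (auto simp: indicator_def intro!: ennreal_leI)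
  finally have "ennreal (2 * exp (3 / 2) / \<tau>) * ennreal (m * (\<tau> / 2)) \<le> ennreal (2 * exp (3 / 2) / \<tau>) *
    (\<integral>\<^sup>+t. ennreal (exp (- t * u - t\<^sup>2 / 2)) * indicator {0..\<tau>} t \<partial>lborel)"
    by (intro mult_left_mono) auto
  moreover have "2 * exp (3 / 2) / \<tau> * (m * (\<tau> / 2)) = max 0 (1 - \<tau> * u)"
    using \<tau> by (simp add: m_def exp_minus field_simps)
  then have "ennreal (2 * exp (3 / 2) / \<tau>) * ennreal (m * (\<tau> / 2)) = ennreal (max 0 (1 - \<tau> * u))"
    using \<tau> by (simp add: ennreal_mult'[symmetric])
  moreover have "ennreal (1 - \<tau> * u) \<le> ennreal (max 0 (1 - \<tau> * u))"
    by (intro ennreal_leI) simp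
  ultimately show ?thesis by (simp only: order_trans)
qed

section \<open>Smoothed shells: the radial and the normal estimate\<close>

context polyhedral
begin

lemma integrable_u: "integrable (std_gaussian d) u"
proof (rule Bochner_Integration.integrable_bound)
  show "integrable (std_gaussian d) (\<lambda>x. \<Sum>j\<in>J. \<bar>dot d (a j) x\<bar>)"
    by (intro Bochner_Integration.integrable_sum integrable_abs integrable_dot_std_gaussian)
  show "AE x in std_gaussian d. norm (u x) \<le> norm (\<Sum>j\<in>J. \<bar>dot d (a j) x\<bar>)"
  proof (rule AE_I2)
    fix x
    have "\<bar>u x\<bar> \<le> (\<Sum>j\<in>J. \<bar>dot d (a j) x\<bar>)"
      unfolding u_def using member_le_sum[of "sel x" J "\<lambda>j. \<bar>dot d (a j) x\<bar>"] sel(1) J by simp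
    then show "norm (u x) \<le> norm (\<Sum>j\<in>J. \<bar>dot d (a j) x\<bar>)" by simp
  qed
qed simp

text \<open>The subgradient inequality for the convex function \<open>f\<close>: the function active
  at \<open>x\<close> remains a lower bound of \<open>f\<close> at the dilated point.\<close>

lemma f_dilation_ge: "f x + c * u x \<le> f (\<lambda>i\<in>{..<d}. (1 + c) * x i)"
proof -
  have "g (sel x) (\<lambda>i\<in>{..<d}. (1 + c) * x i) = f x + c * u x"
    by (subst sel(2)[symmetric]) (simp add: g_def u_def dot_def algebra_simps sum.distrib sum_distrib_left)
  then show ?thesis using g_le_f[OF sel(1)] by metis
qed

context
  fixes s w :: real
  assumes w: "w > 0"
begin

text \<open>The arctangent is explicit, smooth, increasing and bounded: \<open>h\<close> is
  1-Lipschitz with total variation \<open>pi * w\<close>, while its derivative \<open>k\<close>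
  stays at least \<open>1 / 2\<close> where \<open>\<bar>r - s\<bar> \<le> w\<close>.\<close>

definition h :: "real \<Rightarrow> real" where "h r = w * arctan ((r - s) / w)"

definition k :: "real \<Rightarrow> real" where "k r = inverse (1 + ((r - s) / w)\<^sup>2)"

lemma h_deriv: "(h has_real_derivative k r) (at r)"
  unfolding h_def[abs_def] k_def using w by (auto intro!: derivative_eq_intros)

lemma k_bounds: "0 < k r" "k r \<le> 1"
proof -
  have "0 < 1 + ((r - s) / w)\<^sup>2" by (simp add: add_pos_nonneg)
  then show "0 < k r" by (simp add: k_def)
  show "k r \<le> 1" by (simp add: k_def inverse_le_1_iff)
qed

lemma measurable_k [measurable]: "k \<in> borel_measurable borel"
  unfolding k_def[abs_def] by measurable

lemma measurable_h [measurable]: "h \<in> borel_measurable borel"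
  unfolding h_def[abs_def] by (intro borel_measurable_times borel_measurable_continuous_onI continuous_intros) (use w in auto)

lemma h_bound: "\<bar>h r\<bar> \<le> w * (pi / 2)"
  unfolding h_def abs_mult using w arctan_bounded[of "(r - s) / w"]
  by (intro mult_mono) auto

lemma h_mono: "r \<le> r' \<Longrightarrow> h r \<le> h r'"
  unfolding h_def using w by (intro mult_left_mono) (auto simp: arctan_le_iff divide_right_mono)

lemma h_lipschitz: "\<bar>h r - h r'\<bar> \<le> \<bar>r - r'\<bar>"
proof -
  have "\<bar>h r - h r'\<bar> = w * \<bar>arctan ((r - s) / w) - arctan ((r' - s) / w)\<bar>"
    using w by (simp add: h_def abs_mult right_diff_distrib[symmetric])
  also have "\<dots> \<le> w * \<bar>(r - s) / w - (r' - s) / w\<bar>"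
    using w by (intro mult_left_mono abs_arctan_diff_le) auto
  also have "\<dots> = \<bar>r - r'\<bar>" using w by (simp add: diff_divide_distrib[symmetric])
  finally show ?thesis .
qed

text \<open>The integrand is the limit of difference quotients of \<open>h\<close> along
  \<open>f x + c * u x\<close>. As \<open>h\<close> is increasing, \<open>f_dilation_ge\<close>
  replaces this argument by \<open>f\<close> at a dilated point, where the dilation bound applies to
  \<open>h\<close> composed with \<open>f\<close>. Dominated convergence uses that \<open>h\<close>
  is 1-Lipschitz and \<open>u\<close> integrable.\<close>

lemma integral_k_radial_le: "(\<integral>x. k (f x) * u x \<partial>std_gaussian d) \<le> 3 * pi * w * sqrt (real d)"
proof -
  let ?G = "std_gaussian d"
  interpret prob_space ?G by (rule prob_space_std_gaussian)
  \<comment> \<open>The increments tend to 0 and satisfy \<open>d * c n \<le> 1 / 5\<close>, so that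
    \<open>d * (?\<sigma>^2 - 1)^2 \<le> 9 / 25\<close>, within the range of the dilation
    bound.\<close>
  define c where "c n = 1 / (5 * real d * real (Suc n))" for n
  have d1: "real d \<ge> 1" using d by simp
  have c0: "c n > 0" for n using d1 by (simp add: c_def)
  have c5: "real d * c n \<le> 1 / 5" for n
  proof -
    have "real d * c n = 1 / (5 * real (Suc n))" using d1 by (simp add: c_def)
    also have "\<dots> \<le> 1 / 5" by (intro divide_left_mono) auto
    finally show ?thesis .
  qed
  have c1: "c n \<le> 1 / 5" for n
    using c5[of n] mult_right_mono[OF d1, of "c n"] c0[of n] by linarith
  have clim: "c \<longlonglongrightarrow> 0"
  proof -
    have "(\<lambda>n. 1 / (5 * real d) * (1 / real (Suc n))) \<longlonglongrightarrow> 1 / (5 * real d) * 0"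
      by (intro tendsto_intros LIMSEQ_Suc[OF lim_1_over_n])
    then show ?thesis by (simp add: c_def[abs_def] field_simps)
  qed
  define D where "D n x = (h (f x + c n * u x) - h (f x)) / c n" for n x
  have Dlim: "(\<lambda>n. D n x) \<longlonglongrightarrow> k (f x) * u x" for x
  proof -
    have "((\<lambda>y. h (f x + y * u x)) has_real_derivative k (f x + 0 * u x) * u x) (at 0)"
      by (rule DERIV_chain2[OF h_deriv]) (auto intro!: derivative_eq_intros)
    then have "(\<lambda>y. (h (f x + y * u x) - h (f x)) / y) \<midarrow>0\<rightarrow> k (f x) * u x"
      by (simp add: DERIV_def)
    moreover have "filterlim c (at 0) sequentially"
      using clim c0 by (intro filterlim_atI) (auto simp: less_imp_neq[symmetric])
    ultimately show ?thesis unfolding D_def by (rule filterlim_compose)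
  qed
  have Dbound: "\<bar>D n x\<bar> \<le> \<bar>u x\<bar>" for n x
    using h_lipschitz[of "f x + c n * u x" "f x"] c0[of n]
    by (simp add: D_def divide_le_eq abs_mult mult.commute)
  have Dm [measurable]: "D n \<in> borel_measurable (euclid d)" for n
    unfolding D_def[abs_def] by measurable
  have DE: "(\<integral>x. D n x \<partial>?G) \<le> 3 * pi * w * sqrt (real d)" for n
  proof -
    let ?\<sigma> = "1 + c n"
    have \<sigma>: "?\<sigma>\<^sup>2 - 1 \<le> 3 * c n" "0 \<le> ?\<sigma>\<^sup>2 - 1"
      using c0[of n] c1[of n] mult_right_mono[of "c n" 1 "c n"] by (auto simp: power2_eq_square algebra_simps)
    have "real d * (?\<sigma>\<^sup>2 - 1)\<^sup>2 \<le> real d * (3 * c n)\<^sup>2"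
      using \<sigma> by (intro mult_left_mono power_mono) auto
    also have "\<dots> = 9 * ((real d * c n) * c n)" by (simp add: power2_eq_square)
    also have "\<dots> \<le> 9 * (1 / 5 * (1 / 5))"
      using c5[of n] c1[of n] c0[of n] by (intro mult_left_mono mult_mono) auto
    finally have small: "real d * (?\<sigma>\<^sup>2 - 1)\<^sup>2 \<le> 1 / 2" by simp
    have ih: "integrable ?G (\<lambda>x. h (F x))" if [measurable]: "F \<in> borel_measurable (euclid d)" for F
      using h_bound by (intro integrable_const_bound[where B="w * (pi / 2)"]) auto
    have "(\<integral>x. D n x \<partial>?G) = ((\<integral>x. h (f x + c n * u x) \<partial>?G) - (\<integral>x. h (f x) \<partial>?G)) / c n"
      unfolding D_def by (subst integral_divide_zero, subst Bochner_Integration.integral_diff) (auto intro!: ih)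
    also have "\<dots> \<le> ((\<integral>x. h (f (\<lambda>i\<in>{..<d}. ?\<sigma> * x i)) \<partial>?G) - (\<integral>x. h (f x) \<partial>?G)) / c n"
      using c0[of n] by (intro divide_right_mono diff_right_mono integral_mono ih h_mono f_dilation_ge) auto
    also have "\<dots> \<le> (w * (pi / 2) * (2 * (?\<sigma>\<^sup>2 - 1) * sqrt (real d))) / c n"
      using c0[of n] d small h_bound
      by (intro divide_right_mono integral_dilation_le) auto
    also have "\<dots> \<le> (w * (pi / 2) * (2 * (3 * c n) * sqrt (real d))) / c n"
      using c0[of n] \<sigma> w by (intro divide_right_mono mult_left_mono mult_right_mono) auto
    also have "\<dots> = 3 * pi * w * sqrt (real d)" using c0[of n] by simp
    finally show ?thesis .
  qed
  have "(\<lambda>n. \<integral>x. D n x \<partial>?G) \<longlonglongrightarrow> (\<integral>x. k (f x) * u x \<partial>?G)"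
    using integrable_abs[OF integrable_u] Dlim Dbound
    by (intro integral_dominated_convergence[where w="\<lambda>x. \<bar>u x\<bar>"]) auto
  then show ?thesis by (rule LIMSEQ_le_const2) (use DE in auto)
qed

text \<open>After exchanging the integrals, the normal flow removes the weight for each
  \<open>t\<close>. The integral of \<open>k (f x - t)\<close> over \<open>t\<close> is then an
  increment of \<open>h\<close>, at most its oscillation \<open>pi * w\<close>.\<close>

lemma nn_integral_k_normal_le:
  assumes \<tau>: "0 \<le> \<tau>"
  shows "(\<integral>\<^sup>+x. ennreal (k (f x)) *
      (\<integral>\<^sup>+t. ennreal (exp (- t * u x - t\<^sup>2 / 2)) * indicator {0..\<tau>} t \<partial>lborel) \<partial>std_gaussian d)
    \<le> ennreal (pi * w)"
proof -
  let ?G = "std_gaussian d"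
  interpret prob_space ?G by (rule prob_space_std_gaussian)
  interpret pair_sigma_finite ?G lborel ..
  have "(\<integral>\<^sup>+x. ennreal (k (f x)) *
      (\<integral>\<^sup>+t. ennreal (exp (- t * u x - t\<^sup>2 / 2)) * indicator {0..\<tau>} t \<partial>lborel) \<partial>?G)
    = (\<integral>\<^sup>+x. \<integral>\<^sup>+t. ennreal (k (f x)) * ennreal (exp (- t * u x - t\<^sup>2 / 2)) * indicator {0..\<tau>} t \<partial>lborel \<partial>?G)"
    by (subst nn_integral_cmult[symmetric]) (auto simp: mult.assoc)
  also have "\<dots> = (\<integral>\<^sup>+t. \<integral>\<^sup>+x. ennreal (k (f x)) * ennreal (exp (- t * u x - t\<^sup>2 / 2)) * indicator {0..\<tau>} t \<partial>?G \<partial>lborel)"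
    by (rule Fubini'[symmetric]) measurable
  also have "\<dots> \<le> (\<integral>\<^sup>+t. \<integral>\<^sup>+x. ennreal (k (f x - t)) * indicator {0..\<tau>} t \<partial>?G \<partial>lborel)"
  proof (rule nn_integral_mono)
    fix t
    show "(\<integral>\<^sup>+x. ennreal (k (f x)) * ennreal (exp (- t * u x - t\<^sup>2 / 2)) * indicator {0..\<tau>} t \<partial>?G)
      \<le> (\<integral>\<^sup>+x. ennreal (k (f x - t)) * indicator {0..\<tau>} t \<partial>?G)"
      using nn_integral_normal_flow_le[of t "\<lambda>r. ennreal (k r)"]
      by (cases "t \<in> {0..\<tau>}") auto
  qed
  also have "\<dots> = (\<integral>\<^sup>+x. \<integral>\<^sup>+t. ennreal (k (f x - t)) * indicator {0..\<tau>} t \<partial>lborel \<partial>?G)"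
    by (rule Fubini') measurable
  also have "\<dots> \<le> (\<integral>\<^sup>+x. ennreal (pi * w) \<partial>?G)"
  proof (rule nn_integral_mono)
    fix x
    have "(\<integral>\<^sup>+t. ennreal (k (f x - t)) * indicator {0..\<tau>} t \<partial>lborel) = ennreal (- h (f x - \<tau>) - (- h (f x - 0)))"
    proof (rule nn_integral_FTC_Icc)
      fix t
      have "((\<lambda>t. h (f x - t)) has_real_derivative k (f x - t) * (- 1)) (at t)"
        by (rule DERIV_chain2[OF h_deriv]) (auto intro!: derivative_eq_intros)
      from DERIV_minus[OF this]
      show "((\<lambda>t. - h (f x - t)) has_real_derivative k (f x - t)) (at t)"
        by simp
      show "0 \<le> k (f x - t)" using k_bounds(1) by (simp add: less_imp_le)
    qed (use \<tau> in auto)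
    also have "\<dots> \<le> ennreal (pi * w)"
      using h_bound[of "f x - \<tau>"] h_bound[of "f x - 0"] by (intro ennreal_leI) (simp add: mult.commute)
    finally show "(\<integral>\<^sup>+t. ennreal (k (f x - t)) * indicator {0..\<tau>} t \<partial>lborel) \<le> ennreal (pi * w)" .
  qed
  also have "\<dots> = ennreal (pi * w)" by (simp add: emeasure_space_1)
  finally show ?thesis .
qed

text \<open>Split 1 as \<open>(1 - \<tau> * u) + \<tau> * u\<close> under the weight
  \<open>k\<close>: the first part is dominated by the normal flow, the second is the radial
  estimate.\<close>

lemma integral_k_le:
  assumes \<tau>: "0 < \<tau>" "\<tau> \<le> 1"
  shows "(\<integral>x. k (f x) \<partial>std_gaussian d) \<le> 2 * exp (3 / 2) * pi * w / \<tau> + \<tau> * (3 * pi * w * sqrt (real d))"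
proof -
  let ?G = "std_gaussian d"
  let ?I = "\<lambda>x. \<integral>\<^sup>+t. ennreal (exp (- t * u x - t\<^sup>2 / 2)) * indicator {0..\<tau>} t \<partial>lborel"
  interpret prob_space ?G by (rule prob_space_std_gaussian)
  have ik: "integrable ?G (\<lambda>x. k (f x))"
    using k_bounds by (intro integrable_const_bound[where B=1]) (auto simp: less_imp_le)
  have iku: "integrable ?G (\<lambda>x. k (f x) * u x)"
  proof (rule Bochner_Integration.integrable_bound[OF integrable_u])
    show "AE x in ?G. norm (k (f x) * u x) \<le> norm (u x)"
      using k_bounds by (intro AE_I2) (auto simp: abs_mult less_imp_le intro!: mult_left_le_one_le)
  qed simp
  have i: "integrable ?G (\<lambda>x. k (f x) * (1 - \<tau> * u x))"
    using ik integrable_mult_right[OF iku, of \<tau>] by (simp add: algebra_simps)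
  have "(\<integral>\<^sup>+x. ennreal (k (f x) * (1 - \<tau> * u x)) \<partial>?G)
    \<le> (\<integral>\<^sup>+x. ennreal (2 * exp (3 / 2) / \<tau>) * (ennreal (k (f x)) * ?I x) \<partial>?G)"
  proof (rule nn_integral_mono)
    fix x
    have "ennreal (k (f x) * (1 - \<tau> * u x)) = ennreal (k (f x)) * ennreal (1 - \<tau> * u x)"
      using k_bounds(1)[of "f x"] by (intro ennreal_mult') auto
    also have "\<dots> \<le> ennreal (k (f x)) * (ennreal (2 * exp (3 / 2) / \<tau>) * ?I x)"
      by (intro mult_left_mono normal_flow_weight_ge \<tau>) auto
    finally show "ennreal (k (f x) * (1 - \<tau> * u x)) \<le> ennreal (2 * exp (3 / 2) / \<tau>) * (ennreal (k (f x)) * ?I x)"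
      by (simp add: mult_ac)
  qed
  also have "\<dots> = ennreal (2 * exp (3 / 2) / \<tau>) * (\<integral>\<^sup>+x. ennreal (k (f x)) * ?I x \<partial>?G)"
    by (rule nn_integral_cmult) measurable
  also have "\<dots> \<le> ennreal (2 * exp (3 / 2) / \<tau>) * ennreal (pi * w)"
    using \<tau> by (intro mult_left_mono nn_integral_k_normal_le) auto
  also have "\<dots> = ennreal (2 * exp (3 / 2) * pi * w / \<tau>)"
    using \<tau> by (simp add: ennreal_mult'[symmetric] mult.assoc)
  finally have le: "(\<integral>\<^sup>+x. ennreal (k (f x) * (1 - \<tau> * u x)) \<partial>?G) \<le> ennreal (2 * exp (3 / 2) * pi * w / \<tau>)" .
  \<comment> \<open>Since \<open>ennreal\<close> sends negative numbers to 0, the bounded integral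
    is that of the positive part, which dominates the signed one.\<close>
  have "(\<integral>x. k (f x) * (1 - \<tau> * u x) \<partial>?G) \<le> enn2real (\<integral>\<^sup>+x. ennreal (k (f x) * (1 - \<tau> * u x)) \<partial>?G)"
    unfolding real_lebesgue_integral_def[OF i] by simp
  also have "\<dots> \<le> 2 * exp (3 / 2) * pi * w / \<tau>"
    using \<tau> w by (intro enn2real_leI le) auto
  finally have 1: "(\<integral>x. k (f x) * (1 - \<tau> * u x) \<partial>?G) \<le> 2 * exp (3 / 2) * pi * w / \<tau>" .
  have "(\<integral>x. k (f x) \<partial>?G) = (\<integral>x. k (f x) * (1 - \<tau> * u x) + \<tau> * (k (f x) * u x) \<partial>?G)"
    by (intro Bochner_Integration.integral_cong) (auto simp: algebra_simps)
  also have "\<dots> = (\<integral>x. k (f x) * (1 - \<tau> * u x) \<partial>?G) + \<tau> * (\<integral>x. k (f x) * u x \<partial>?G)"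
    using i iku by simp
  also have "\<dots> \<le> 2 * exp (3 / 2) * pi * w / \<tau> + \<tau> * (3 * pi * w * sqrt (real d))"
    using \<tau> by (intro add_mono 1 mult_left_mono integral_k_radial_le) auto
  finally show ?thesis .
qed

end

text \<open>The indicator of the shell is at most twice the bump \<open>k\<close> of the same centre
  and width.\<close>

lemma shell_bound:
  assumes w: "w > 0"
  shows "measure (std_gaussian d) {x \<in> space (euclid d). \<bar>f x - s\<bar> \<le> w}
    \<le> (4 * exp (3 / 2) + 6) * pi * real d powr (1 / 4) * w"
proof -
  let ?G = "std_gaussian d" and ?S = "{x \<in> space (euclid d). \<bar>f x - s\<bar> \<le> w}"
  let ?k = "k s w"
  interpret prob_space ?G by (rule prob_space_std_gaussian)
  \<comment> \<open>This choice makes the two contributions \<open>1 / \<tau>\<close> and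
    \<open>\<tau> * sqrt d\<close> both equal to \<open>d powr (1 / 4)\<close>.\<close>
  define \<tau> where "\<tau> = real d powr (- 1 / 4)"
  have d1: "real d \<ge> 1" using d by simp
  have \<tau>: "0 < \<tau>" "\<tau> \<le> 1" using d1 powr_mono[of "- 1 / 4" 0 "real d"] by (auto simp: \<tau>_def)
  have S: "?S \<in> sets ?G" by measurable
  have "measure ?G ?S = (\<integral>x. indicator ?S x \<partial>?G)" using S by simp
  also have "\<dots> \<le> (\<integral>x. 2 * ?k (f x) \<partial>?G)"
  proof (rule integral_mono)
    show "integrable ?G (indicator ?S :: _ \<Rightarrow> real)" using S by (intro integrable_real_indicator) (auto simp: less_top[symmetric])
    show "integrable ?G (\<lambda>x. 2 * ?k (f x))"
      using k_bounds[OF w] measurable_k[OF w] measurable_f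
      by (intro integrable_mult_right integrable_const_bound[where B=1]) (auto simp: less_imp_le)
    fix x
    show "indicator ?S x \<le> 2 * ?k (f x)"
    proof (cases "\<bar>f x - s\<bar> \<le> w")
      case True
      then have "\<bar>(f x - s) / w\<bar> \<le> 1" using w by simp
      then have "((f x - s) / w)\<^sup>2 \<le> 1" by (simp add: abs_square_le_1)
      then have "inverse 2 \<le> ?k (f x)" unfolding k_def[OF w] by (intro le_imp_inverse_le add_pos_nonneg) auto
      then show ?thesis by (simp add: indicator_def)
    qed (use k_bounds(1)[OF w, of s "f x"] in \<open>auto simp: indicator_def less_imp_le\<close>)
  qed
  also have "\<dots> = 2 * (\<integral>x. ?k (f x) \<partial>?G)" by simp
  also have "\<dots> \<le> 2 * (2 * exp (3 / 2) * pi * w / \<tau> + \<tau> * (3 * pi * w * sqrt (real d)))"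
    by (intro mult_left_mono integral_k_le[OF w \<tau>]) simp
  also have "\<dots> = (4 * exp (3 / 2) + 6) * pi * real d powr (1 / 4) * w"
  proof -
    have 1: "1 / \<tau> = real d powr (1 / 4)" by (simp add: \<tau>_def powr_minus_divide)
    have 2: "\<tau> * sqrt (real d) = real d powr (1 / 4)"
      using d1 by (simp add: \<tau>_def powr_half_sqrt[symmetric] powr_add[symmetric])
    have "2 * (2 * exp (3 / 2) * pi * w / \<tau> + \<tau> * (3 * pi * w * sqrt (real d)))
      = 4 * exp (3 / 2) * pi * w * (1 / \<tau>) + 6 * pi * w * (\<tau> * sqrt (real d))"
      by (simp add: algebra_simps)
    then show ?thesis unfolding 1 2 by (simp add: algebra_simps)
  qed
  finally show ?thesis .
qed

end

section \<open>Separation of convex sets from points\<close>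

lemma dot_diff_right: "dot d a (\<lambda>i. x i - y i) = dot d a x - dot d a y"
  by (simp add: dot_def algebra_simps sum_subtractf)

lemma dot_diff_left: "dot d (\<lambda>i. x i - y i) a = dot d x a - dot d y a"
  by (simp add: dot_def algebra_simps sum_subtractf)

lemma dot_cmult_right: "dot d a (\<lambda>i. c * x i) = c * dot d a x"
  by (simp add: dot_def algebra_simps sum_distrib_left)

lemma dot_cmult_left: "dot d (\<lambda>i. c * x i) a = c * dot d x a"
  by (simp add: dot_def algebra_simps sum_distrib_left)

lemma dot_sum_right: "dot d a (\<lambda>i. \<Sum>j\<in>I. l j * y j i) = (\<Sum>j\<in>I. l j * dot d a (y j))"
  unfolding dot_def sum_distrib_left by (subst sum.swap) (simp add: mult_ac)

lemma dot_cong: "(\<And>i. i < d \<Longrightarrow> x i = x' i) \<Longrightarrow> (\<And>i. i < d \<Longrightarrow> y i = y' i) \<Longrightarrow> dot d x y = dot d x' y'"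
  by (simp add: dot_def)

text \<open>The induction step projects the other vectors along \<open>y p\<close>: a separating functional lifts, while a
  vanishing combination lifts to a multiple \<open>C\<close> of \<open>y p\<close>, and for \<open>C > 0\<close> every functional negative
  on the other vectors is negative on \<open>y p\<close> as well.\<close>

lemma gordan_alternative:
  fixes y :: "'i \<Rightarrow> nat \<Rightarrow> real"
  assumes "finite I"
  shows "(\<exists>a. \<forall>j\<in>I. dot d a (y j) < 0) \<or>
    (\<exists>l. (\<forall>j\<in>I. 0 \<le> l j) \<and> sum l I = 1 \<and> (\<forall>i<d. (\<Sum>j\<in>I. l j * y j i) = 0))"
  using assms
proof (induction I arbitrary: y rule: finite_induct)
  case empty
  then show ?case by simp
next
  case (insert p I)
  define n where "n = dot d (y p) (y p)"
  show ?case
  \<comment> \<open>If \<open>y p\<close> vanishes, the unit mass at \<open>p\<close> is a vanishing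
    combination; otherwise projecting along \<open>y p\<close> is possible.\<close>
  proof (cases "n = 0")
    case True
    then have 0: "\<forall>i<d. y p i = 0"
      by (simp add: n_def dot_def sum_nonneg_eq_0_iff)
    let ?l = "\<lambda>j. if j = p then 1 else 0 :: real"
    have "(\<forall>j\<in>insert p I. 0 \<le> ?l j) \<and> sum ?l (insert p I) = 1 \<and> (\<forall>i<d. (\<Sum>j\<in>insert p I. ?l j * y j i) = 0)"
      using insert.hyps 0 by (auto simp: if_distrib[of "\<lambda>t. t * _"] cong: if_cong)
    then show ?thesis by (intro disjI2 exI[of _ ?l])
  next
    case False
    then have n: "n > 0" by (auto simp: n_def dot_def less_le sum_nonneg)
    define c where "c j = dot d (y p) (y j) / n" for j
    define z where "z j i = y j i - c j * y p i" for j i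
    consider (sep) a where "\<forall>j\<in>I. dot d a (z j) < 0"
      | (comb) l where "\<forall>j\<in>I. 0 \<le> l j" "sum l I = 1" "\<forall>i<d. (\<Sum>j\<in>I. l j * z j i) = 0"
      using insert.IH[of z] by blast
    then show ?thesis
    proof cases
      case sep
      define a' where "a' i = a i - dot d a (y p) / n * y p i" for i
      have a'p: "dot d a' (y p) = 0"
        using n unfolding a'_def[abs_def] dot_diff_left dot_cmult_left n_def[symmetric] by simp
      have a'j: "dot d a' (y j) = dot d a (z j)" for j
        unfolding a'_def[abs_def] z_def[abs_def] dot_diff_left dot_diff_right dot_cmult_left dot_cmult_right
        by (simp add: c_def)
      \<comment> \<open>Tilting \<open>a'\<close> by a small multiple of \<open>- y p\<close> makes
        it strictly negative on \<open>y p\<close>, where it is zero, and keeps the finitely many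
        strict inequalities.\<close>
      have "\<forall>\<^sub>F t in at_right 0. \<forall>j\<in>I. dot d a (z j) - t * dot d (y p) (y j) < 0"
      proof (intro eventually_ball_finite insert.hyps ballI)
        fix j assume j: "j \<in> I"
        have "((\<lambda>t. dot d a (z j) - t * dot d (y p) (y j)) \<longlongrightarrow> dot d a (z j) - 0 * dot d (y p) (y j)) (at_right 0)"
          by (intro tendsto_intros)
        then show "\<forall>\<^sub>F t in at_right 0. dot d a (z j) - t * dot d (y p) (y j) < 0"
          using sep j by (auto dest: order_tendstoD(2))
      qed
      moreover have "\<forall>\<^sub>F t in at_right 0. (t::real) > 0"
        by (rule eventually_at_right_less)
      ultimately have "\<forall>\<^sub>F t in at_right 0. t > 0 \<and> (\<forall>j\<in>I. dot d a (z j) - t * dot d (y p) (y j) < 0)"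
        by eventually_elim blast
      then obtain t where t: "t > 0" "\<forall>j\<in>I. dot d a (z j) - t * dot d (y p) (y j) < 0"
        by (metis (no_types, lifting) eventually_happens' trivial_limit_at_right_real)
      have "\<forall>j\<in>insert p I. dot d (\<lambda>i. a' i - t * y p i) (y j) < 0"
        unfolding dot_diff_left dot_cmult_left a'j[symmetric]
        using t n a'p by (auto simp: a'j n_def[symmetric])
      then show ?thesis by (intro disjI1 exI)
    next
      case comb
      define C where "C = (\<Sum>j\<in>I. l j * c j)"
      have yC: "(\<Sum>j\<in>I. l j * y j i) = C * y p i" if "i < d" for i
        using comb(3) that by (simp add: z_def C_def algebra_simps sum_subtractf sum_distrib_left)
      show ?thesis
      proof (cases "C \<le> 0")
        case True
        \<comment> \<open>The weight \<open>- C \<ge> 0\<close> on \<open>y p\<close> cancels the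
          remainder \<open>C * y p\<close>; division by the total mass \<open>1 - C\<close>
          normalises.\<close>
        define l' where "l' j = (if j = p then - C else l j) / (1 - C)" for j
        have l'I: "(\<Sum>j\<in>I. l' j * w j) = (\<Sum>j\<in>I. l j * w j) / (1 - C)" for w :: "'i \<Rightarrow> real"
          unfolding sum_divide_distrib using insert.hyps by (intro sum.cong) (auto simp: l'_def)
        have "\<forall>j\<in>insert p I. 0 \<le> l' j" using comb(1) True by (auto simp: l'_def intro!: divide_nonneg_nonneg divide_nonpos_pos)
        moreover have "sum l' (insert p I) = 1"
          using insert.hyps l'I[of "\<lambda>_. 1"] comb(2) True by (simp add: l'_def[of p] add_divide_distrib[symmetric] diff_divide_distrib[symmetric])
        moreover have "\<forall>i<d. (\<Sum>j\<in>insert p I. l' j * y j i) = 0"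
          using insert.hyps by (auto simp: l'I yC l'_def[of p] add_divide_distrib[symmetric] diff_divide_distrib[symmetric])
        ultimately show ?thesis by (intro disjI2 exI[of _ l'] conjI)
      next
        case False
        consider (sep') a where "\<forall>j\<in>I. dot d a (y j) < 0"
          | (comb') l where "\<forall>j\<in>I. 0 \<le> l j" "sum l I = 1" "\<forall>i<d. (\<Sum>j\<in>I. l j * y j i) = 0"
          using insert.IH[of y] by blast
        then show ?thesis
        proof cases
          case sep'
          have "C * dot d a (y p) = dot d a (\<lambda>i. \<Sum>j\<in>I. l j * y j i)"
            unfolding dot_cmult_right[symmetric] by (intro dot_cong) (simp_all add: yC)
          also have "\<dots> = (\<Sum>j\<in>I. l j * dot d a (y j))" by (rule dot_sum_right)
          also have "\<dots> < 0"
          proof -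
            have le: "\<forall>j\<in>I. 0 \<le> l j * - dot d a (y j)"
              using sep' comb(1) by (auto simp: less_imp_le intro!: mult_nonneg_nonpos)
            obtain j where "j \<in> I" "l j \<noteq> 0" using comb(2) by (metis sum.neutral zero_neq_one)
            then have "0 < l j" "dot d a (y j) < 0" using sep' comb(1) by (auto simp: less_le)
            then have "0 < l j * - dot d a (y j)" by (simp add: mult_pos_neg)
            then have "0 < (\<Sum>j\<in>I. l j * - dot d a (y j))"
              using le \<open>j \<in> I\<close> insert.hyps by (intro sum_pos2) auto
            then show ?thesis by (simp add: sum_negf)
          qed
          finally have "dot d a (y p) < 0" using False by (simp add: mult_less_0_iff)
          then have "\<forall>j\<in>insert p I. dot d a (y j) < 0" using sep' by simp
          then show ?thesis by (intro disjI1 exI)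
        next
          case comb'
          define l' where "l' j = (if j = p then 0 else l j)" for j
          have "(\<Sum>j\<in>insert p I. l' j * w j) = (\<Sum>j\<in>I. l j * w j)" for w :: "'i \<Rightarrow> real"
            using insert.hyps by (auto simp: l'_def intro!: sum.cong)
          from this[of "\<lambda>_. 1"] this[of "\<lambda>j. y j _"]
          have "(\<forall>j\<in>insert p I. 0 \<le> l' j) \<and> sum l' (insert p I) = 1 \<and> (\<forall>i<d. (\<Sum>j\<in>insert p I. l' j * y j i) = 0)"
            using comb' by (auto simp: l'_def)
          then show ?thesis by (intro disjI2 exI[of _ l'])
        qed
      qed
    qed
  qed
qed

text \<open>Induction on the index set: split off one point and rescale the other weights by
  \<open>1 - l p\<close>, unless \<open>l p = 1\<close>, when they all vanish.\<close>

lemma convex_in_sum: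
  assumes A: "convex_in d A" and I: "finite I" and l: "\<And>j. j \<in> I \<Longrightarrow> 0 \<le> l j" "sum l I = 1"
    and y: "\<And>j. j \<in> I \<Longrightarrow> y j \<in> A"
  shows "(\<lambda>i\<in>{..<d}. \<Sum>j\<in>I. l j * y j i) \<in> A"
  using I l y
proof (induction I arbitrary: l rule: finite_induct)
  case empty
  then show ?case by simp
next
  case (insert p I)
  have ext: "(\<lambda>i\<in>{..<d}. x i) = x" if "x \<in> A" for x
    using A that by (auto simp: convex_in_def space_euclid PiE_def extensional_def fun_eq_iff)
  have s: "sum l I = 1 - l p" using insert.hyps insert.prems(2) by simp
  have lI: "\<And>j. j \<in> I \<Longrightarrow> 0 \<le> l j" using insert.prems(1) by simp
  show ?case
  proof (cases "l p = 1")
    case True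
    then have "\<forall>j\<in>I. l j = 0" using s lI insert.hyps by (simp add: sum_nonneg_eq_0_iff)
    then have "(\<lambda>i\<in>{..<d}. \<Sum>j\<in>insert p I. l j * y j i) = y p"
      using insert.hyps True insert.prems(3)[of p] ext[of "y p"] by simp
    then show ?thesis using insert.prems(3)[of p] by simp
  next
    case False
    have "0 \<le> sum l I" using lI by (rule sum_nonneg)
    then have p: "0 \<le> l p" "0 < 1 - l p" using s False insert.prems(1)[of p] by auto
    let ?z = "\<lambda>i\<in>{..<d}. \<Sum>j\<in>I. l j / (1 - l p) * y j i"
    have "?z \<in> A"
      using p s lI insert.prems(3)
      by (intro insert.IH) (auto simp: sum_divide_distrib[symmetric])
    moreover have "(\<lambda>i\<in>{..<d}. u * x i + v * x' i) \<in> A"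
      if "x \<in> A" "x' \<in> A" "0 \<le> u" "0 \<le> v" "u + v = 1" for x x' u v
      using A that unfolding convex_in_def by blast
    ultimately have "(\<lambda>i\<in>{..<d}. l p * y p i + (1 - l p) * ?z i) \<in> A"
      using insert.prems(3)[of p] p by fastforce
    also have "(\<lambda>i\<in>{..<d}. l p * y p i + (1 - l p) * ?z i) = (\<lambda>i\<in>{..<d}. \<Sum>j\<in>insert p I. l j * y j i)"
      using insert.hyps p by (auto simp: fun_eq_iff sum_distrib_left intro!: sum.cong)
    finally show ?thesis .
  qed
qed

text \<open>Apply the alternative to the differences \<open>y - k\<close>: a vanishing convex
  combination of them would exhibit \<open>k\<close> as a convex combination of points of
  \<open>A\<close>. Otherwise strict negativity forces the functional to be nonzero, so it can be
  normalised.\<close>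

lemma convex_in_separation:
  assumes d: "d \<ge> 1" and A: "convex_in d A" and F: "finite F" "F \<subseteq> A"
    and k: "k \<in> space (euclid d)" "k \<notin> A"
  obtains a where "dot d a a = 1" "\<And>y. y \<in> F \<Longrightarrow> dot d a y \<le> dot d a k"
proof -
  consider (sep) a where "\<forall>y\<in>F. dot d a (\<lambda>i. y i - k i) < 0"
    | (comb) l where "\<forall>j\<in>F. 0 \<le> l j" "sum l F = 1" "\<forall>i<d. (\<Sum>j\<in>F. l j * (j i - k i)) = 0"
    using gordan_alternative[OF F(1), of d "\<lambda>y i. y i - k i"] by blast
  then show ?thesis
  proof cases
    case sep
    show ?thesis
    proof (cases "F = {}")
      \<comment> \<open>For empty \<open>F\<close> the functional may be zero; a coordinate vector
        serves instead.\<close>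
      case True
      have "dot d (\<lambda>i. if i = 0 then 1 else 0) (\<lambda>i. if i = 0 then 1 else 0) = 1"
        using d by (simp add: dot_def if_distrib[of "\<lambda>t. t * _"] cong: if_cong)
      then show ?thesis using True that by blast
    next
      case False
      let ?n = "dot d a a"
      have n: "?n > 0"
      proof (rule ccontr)
        assume "\<not> ?n > 0"
        moreover have "0 \<le> ?n" by (simp add: dot_def sum_nonneg)
        ultimately have "\<forall>i<d. a i = 0" by (simp add: dot_def sum_nonneg_eq_0_iff)
        then have "dot d a x = 0" for x by (simp add: dot_def)
        then show False using sep False by auto
      qed
      let ?a = "\<lambda>i. 1 / sqrt ?n * a i"
      have "dot d ?a ?a = 1"
        unfolding dot_cmult_left dot_cmult_right using n by (simp add: field_simps)
      moreover have "dot d ?a y \<le> dot d ?a k" if "y \<in> F" for y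
        unfolding dot_cmult_left using sep that n
        by (intro mult_left_mono) (auto simp: dot_diff_right less_imp_le)
      ultimately show ?thesis using that by blast
    qed
  next
    case comb
    have "(\<lambda>i\<in>{..<d}. \<Sum>j\<in>F. l j * j i) \<in> A"
      using comb F by (intro convex_in_sum[OF A]) auto
    moreover have "(\<Sum>j\<in>F. l j * j i) = k i" if "i < d" for i
      using comb(2,3) that by (simp add: algebra_simps sum_subtractf sum_distrib_left[symmetric])
    then have "(\<lambda>i\<in>{..<d}. \<Sum>j\<in>F. l j * j i) = k"
      using k(1) by (auto simp: space_euclid PiE_def extensional_def fun_eq_iff)
    ultimately show ?thesis using k(2) by simp
  qed
qed

lemma dot_diff_le_edist:
  assumes "dot d a a = 1"
  shows "\<bar>dot d a x - dot d a y\<bar> \<le> edist d x y"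
proof -
  have "L2_set a {..<d} = 1" using assms by (simp add: L2_set_def dot_def power2_eq_square)
  then have "(\<Sum>i<d. \<bar>a i\<bar> * \<bar>x i - y i\<bar>) \<le> edist d x y"
    using L2_set_mult_ineq[of a "\<lambda>i. x i - y i" "{..<d}"] by (simp add: edist_def)
  moreover have "\<bar>dot d a x - dot d a y\<bar> \<le> (\<Sum>i<d. \<bar>a i\<bar> * \<bar>x i - y i\<bar>)"
  proof -
    have "dot d a x - dot d a y = (\<Sum>i<d. a i * (x i - y i))"
      by (simp add: dot_def algebra_simps sum_subtractf)
    then show ?thesis by (simp only: abs_mult[symmetric] sum_abs)
  qed
  ultimately show ?thesis by simp
qed

text \<open>A maximum of 1-Lipschitz functions is 1-Lipschitz; unit normals give the constant by
  Cauchy-Schwarz.\<close>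

lemma (in polyhedral) f_lipschitz: "f x \<le> f y + edist d x y"
  unfolding f_le_iff
proof
  fix j assume j: "j \<in> J"
  show "g j x \<le> f y + edist d x y"
    using dot_diff_le_edist[OF unit[OF j], of x y] g_le_f[OF j, of y] by (simp add: g_def)
qed

section \<open>Polyhedral approximation and couplings\<close>

text \<open>A numbering of the half-open cubes of side \<open>\<delta> / d\<close>. For this side
  even the l1 diameter is at most \<open>\<delta>\<close>, and a single natural number lets a cube
  also serve as the index of a face.\<close>

definition cube_code :: "nat \<Rightarrow> real \<Rightarrow> (nat \<Rightarrow> real) \<Rightarrow> nat" where
  "cube_code d \<delta> x = to_nat (map (\<lambda>i. \<lfloor>x i * real d / \<delta>\<rfloor>) [0..<d])"

lemma measurable_cube_code [measurable]: "cube_code d \<delta> \<in> euclid d \<rightarrow>\<^sub>M count_space UNIV"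
proof -
  have eq: "cube_code d \<delta> x = n \<longleftrightarrow> (\<exists>L::int list. to_nat L = n \<and> length L = d \<and> (\<forall>i\<in>{..<d}. \<lfloor>x i * real d / \<delta>\<rfloor> = L ! i))" for x n
  proof
    let ?L = "map (\<lambda>i. \<lfloor>x i * real d / \<delta>\<rfloor>) [0..<d]"
    assume "cube_code d \<delta> x = n"
    then show "\<exists>L::int list. to_nat L = n \<and> length L = d \<and> (\<forall>i\<in>{..<d}. \<lfloor>x i * real d / \<delta>\<rfloor> = L ! i)"
      by (intro exI[of _ ?L]) (simp add: cube_code_def)
  next
    assume "\<exists>L::int list. to_nat L = n \<and> length L = d \<and> (\<forall>i\<in>{..<d}. \<lfloor>x i * real d / \<delta>\<rfloor> = L ! i)"
    then obtain L :: "int list" where L: "to_nat L = n" "length L = d" "\<forall>i\<in>{..<d}. \<lfloor>x i * real d / \<delta>\<rfloor> = L ! i"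
      by blast
    then have "map (\<lambda>i. \<lfloor>x i * real d / \<delta>\<rfloor>) [0..<d] = L" by (intro nth_equalityI) auto
    then show "cube_code d \<delta> x = n" using L(1) by (simp add: cube_code_def)
  qed
  have "Measurable.pred (euclid d) (\<lambda>x. cube_code d \<delta> x = n)" for n
    unfolding eq by measurable
  then show ?thesis
    by (intro measurable_count_space_eq2_countable[THEN iffD2]) (auto simp: pred_def vimage_def Int_def conj_commute)
qed

lemma edist_cube_code_le:
  assumes d: "d \<ge> 1" and \<delta>: "\<delta> > 0" and eq: "cube_code d \<delta> x = cube_code d \<delta> y"
  shows "edist d x y \<le> \<delta>"
proof -
  have "\<bar>x i - y i\<bar> \<le> \<delta> / real d" if i: "i < d" for i
  proof -
    have "\<lfloor>x i * real d / \<delta>\<rfloor> = \<lfloor>y i * real d / \<delta>\<rfloor>"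
      using eq i by (auto simp: cube_code_def)
    then have "\<bar>x i * real d / \<delta> - y i * real d / \<delta>\<bar> \<le> 1" by linarith
    also have "x i * real d / \<delta> - y i * real d / \<delta> = (x i - y i) * (real d / \<delta>)"
      by (simp add: algebra_simps)
    finally show ?thesis using d \<delta> by (simp add: abs_mult pos_le_divide_eq pos_divide_le_eq)
  qed
  then have "(\<Sum>i<d. \<bar>x i - y i\<bar>) \<le> (\<Sum>i<d. \<delta> / real d)" by (intro sum_mono) auto
  also have "\<dots> = \<delta>" using d by simp
  finally show ?thesis
    using L2_set_le_sum_abs[of "\<lambda>i. x i - y i" "{..<d}"] by (simp add: edist_def)
qed

text \<open>One point of \<open>A\<close> and one point outside \<open>A\<close> are picked in each cube, and only these finitely many
  points are separated: \<open>A\<close> need not be closed, and its boundary may carry mass.\<close>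

lemma convex_polyhedral_approx:
  assumes d: "d \<ge> 1" and A: "convex_in d A" and \<delta>: "\<delta> > 0"
    and M: "\<And>M. M \<in> S \<Longrightarrow> M \<in> prob_measures d" "finite S"
  obtains V where "V \<in> sets (euclid d)" "\<And>M. M \<in> S \<Longrightarrow> measure M V \<ge> 1 - \<delta>" "V \<subseteq> A"
  | V J a b where "V \<in> sets (euclid d)" "\<And>M. M \<in> S \<Longrightarrow> measure M V \<ge> 1 - \<delta>" "polyhedral d J a"
      "\<And>x. x \<in> V \<Longrightarrow> x \<in> A \<Longrightarrow> polyhedral.f d J a b x \<le> \<delta>"
      "\<And>x. x \<in> V \<Longrightarrow> x \<notin> A \<Longrightarrow> - \<delta> \<le> polyhedral.f d J a b x"
proof -
  let ?e = "cube_code d \<delta>"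
  define V where "V N = {x \<in> space (euclid d). ?e x < N}" for N
  have V [measurable]: "V N \<in> sets (euclid d)" for N unfolding V_def by measurable
  \<comment> \<open>The cubes are countably many and exhaust the space, so the first
    \<open>N\<close> of them carry almost all mass, with one \<open>N\<close> for the finitely many
    measures.\<close>
  have "\<forall>\<^sub>F N in sequentially. \<forall>M\<in>S. measure M (V N) \<ge> 1 - \<delta>"
  proof (intro eventually_ball_finite M ballI)
    fix M assume "M \<in> S"
    then have M': "prob_space M" "sets M = sets (euclid d)" using M by (auto simp: prob_measures_def)
    interpret prob_space M by fact
    have "(\<lambda>N. measure M (V N)) \<longlonglongrightarrow> measure M (\<Union>N. V N)"
      by (rule finite_Lim_measure_incseq) (auto simp: M' incseq_def V_def intro: less_le_trans)
    also have "(\<Union>N. V N) = space M"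
      using sets_eq_imp_space_eq[OF M'(2)] by (auto simp: V_def)
    finally have "(\<lambda>N. measure M (V N)) \<longlonglongrightarrow> 1" by (simp add: prob_space)
    then have "\<forall>\<^sub>F N in sequentially. 1 - \<delta> < measure M (V N)"
      using \<delta> by (intro order_tendstoD) auto
    then show "\<forall>\<^sub>F N in sequentially. 1 - \<delta> \<le> measure M (V N)"
      by eventually_elim simp
  qed
  then obtain N where N: "\<And>M. M \<in> S \<Longrightarrow> measure M (V N) \<ge> 1 - \<delta>"
    by (auto simp: eventually_sequentially)
  define F where "F = (\<lambda>n. SOME y. y \<in> A \<and> ?e y = n) ` {n\<in>{..<N}. \<exists>y. y \<in> A \<and> ?e y = n}"
  have F: "finite F" "F \<subseteq> A"
  proof -
    show "finite F" by (simp add: F_def)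
    have "(SOME y. y \<in> A \<and> ?e y = n) \<in> A" if "\<exists>y. y \<in> A \<and> ?e y = n" for n
      using someI_ex[OF that] by simp
    then show "F \<subseteq> A" by (simp add: F_def image_subset_iff)
  qed
  \<comment> \<open>Faces are indexed by the cubes that meet the complement of \<open>A\<close>. If
    there are none, \<open>V N\<close> lies inside \<open>A\<close>, which is the first
    alternative.\<close>
  define J where "J = {n\<in>{..<N}. \<exists>x. x \<in> space (euclid d) - A \<and> ?e x = n}"
  show ?thesis
  proof (cases "J = {}")
    case True
    then have "V N \<subseteq> A" by (auto simp: V_def J_def)
    then show ?thesis using that(1)[OF V N] by blast
  next
    case False
    have "\<forall>n\<in>J. \<exists>x. x \<in> space (euclid d) - A \<and> ?e x = n" by (auto simp: J_def)
    from bchoice[OF this] obtain p where "\<forall>n\<in>J. p n \<in> space (euclid d) - A \<and> ?e (p n) = n"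
      by blast
    then have p: "p n \<in> space (euclid d) - A \<and> ?e (p n) = n" if "n \<in> J" for n
      using that by blast
    have "\<forall>n\<in>J. \<exists>a. dot d a a = 1 \<and> (\<forall>y\<in>F. dot d a y \<le> dot d a (p n))"
    proof
      fix n assume "n \<in> J"
      then obtain a where "dot d a a = 1" "\<And>y. y \<in> F \<Longrightarrow> dot d a y \<le> dot d a (p n)"
        using convex_in_separation[OF d A F, of "p n"] p by blast
      then show "\<exists>a. dot d a a = 1 \<and> (\<forall>y\<in>F. dot d a y \<le> dot d a (p n))" by blast
    qed
    from bchoice[OF this] obtain a
      where a': "\<forall>n\<in>J. dot d (a n) (a n) = 1 \<and> (\<forall>y\<in>F. dot d (a n) y \<le> dot d (a n) (p n))"
      by blast
    then have a: "n \<in> J \<Longrightarrow> dot d (a n) (a n) = 1"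
      "n \<in> J \<Longrightarrow> y \<in> F \<Longrightarrow> dot d (a n) y \<le> dot d (a n) (p n)" for n y
      by blast+
    \<comment> \<open>Each bounding hyperplane passes through the chosen outer point
      \<open>p n\<close>: hence \<open>f \<le> 0\<close> on \<open>F\<close> and
      \<open>f \<ge> 0\<close> at the outer points, and the Lipschitz bound carries this to the
      whole cubes with error \<open>\<delta>\<close>.\<close>
    define b where "b n = dot d (a n) (p n)" for n
    interpret polyhedral d J a b
      using d False a(1) by unfold_locales (auto simp: J_def)
    show ?thesis
    proof (rule that(2)[OF V N polyhedral_axioms])
      fix x assume x: "x \<in> V N" "x \<in> A"
      let ?y = "SOME y. y \<in> A \<and> ?e y = ?e x"
      have y: "?y \<in> A \<and> ?e ?y = ?e x" by (rule someI[of _ x]) (use x in simp)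
      have yF: "?y \<in> F" unfolding F_def using x by (intro imageI) (auto simp: V_def)
      have "f ?y \<le> 0" unfolding f_le_iff using a(2) yF by (simp add: g_def b_def)
      moreover have "edist d x ?y \<le> \<delta>" using y by (intro edist_cube_code_le d \<delta>) simp
      ultimately show "f x \<le> \<delta>" using f_lipschitz[of x ?y] by linarith
    next
      fix x assume x: "x \<in> V N" "x \<notin> A"
      then have n: "?e x \<in> J" by (auto simp: V_def J_def)
      have "edist d (p (?e x)) x \<le> \<delta>" using p[OF n] by (intro edist_cube_code_le d \<delta>) simp
      moreover have "0 \<le> f (p (?e x))" using g_le_f[OF n, of "p (?e x)"] by (simp add: g_def b_def)
      ultimately show "- \<delta> \<le> f x" using f_lipschitz[of "p (?e x)" x] by linarith
    qed
  qed
qed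

section \<open>Comparison of measures along a coupling, and the choice of the width\<close>

lemma measurable_edist [measurable]:
  "(\<lambda>p. edist d (fst p) (snd p)) \<in> borel_measurable (euclid d \<Otimes>\<^sub>M euclid d)"
proof -
  have [measurable]: "(\<lambda>p. fst p i) \<in> borel_measurable (euclid d \<Otimes>\<^sub>M euclid d)"
    "(\<lambda>p. snd p i) \<in> borel_measurable (euclid d \<Otimes>\<^sub>M euclid d)" if "i < d" for i
    using measurable_compose[OF measurable_fst measurable_euclid_component[OF that]]
      measurable_compose[OF measurable_snd measurable_euclid_component[OF that]] by auto
  show ?thesis
    unfolding edist_def L2_set_def
    by (intro measurable_compose[OF _ borel_measurable_sqrt] borel_measurable_sum borel_measurable_power borel_measurable_diff) auto
qed

text \<open>By Markov's inequality for the squared distance, coupled points are at distance at least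
  \<open>\<epsilon>\<close> with probability at most \<open>c / \<epsilon>^2\<close>; otherwise
  \<open>near\<close> applies.\<close>

lemma coupling_measure_le:
  assumes \<gamma>: "\<gamma> \<in> couplings d \<mu> \<nu>" and \<epsilon>: "\<epsilon> > 0" and c: "c \<ge> 0"
    and cost: "(\<integral>\<^sup>+(x, y). ennreal ((edist d x y)\<^sup>2) \<partial>\<gamma>) \<le> ennreal c"
    and S [measurable]: "S1 \<in> sets (euclid d)" "S2 \<in> sets (euclid d)"
    and near: "\<And>x y. x \<in> S1 \<Longrightarrow> y \<in> space (euclid d) \<Longrightarrow> edist d x y < \<epsilon> \<Longrightarrow> y \<in> S2"
  shows "measure \<mu> S1 \<le> measure \<nu> S2 + c / \<epsilon>\<^sup>2"
proof -
  have g: "prob_space \<gamma>" and sg [measurable_cong]: "sets \<gamma> = sets (euclid d \<Otimes>\<^sub>M euclid d)"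
    and m: "distr \<gamma> (euclid d) fst = \<mu>" "distr \<gamma> (euclid d) snd = \<nu>"
    using \<gamma> by (auto simp: couplings_def)
  interpret prob_space \<gamma> by fact
  have sp: "space \<gamma> = space (euclid d) \<times> space (euclid d)"
    using sets_eq_imp_space_eq[OF sg] by (simp add: space_pair_measure)
  let ?E = "{p \<in> space \<gamma>. \<epsilon>\<^sup>2 \<le> (edist d (fst p) (snd p))\<^sup>2}"
  have E: "measure \<gamma> ?E \<le> c / \<epsilon>\<^sup>2"
  proof -
    have "emeasure \<gamma> {p \<in> space \<gamma>. 1 \<le> ennreal (1 / \<epsilon>\<^sup>2) * ennreal ((edist d (fst p) (snd p))\<^sup>2)}
      \<le> ennreal (1 / \<epsilon>\<^sup>2) * (\<integral>\<^sup>+p. ennreal ((edist d (fst p) (snd p))\<^sup>2) * indicator (space \<gamma>) p \<partial>\<gamma>)"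
      by (rule nn_integral_Markov_inequality) auto
    also have "(\<integral>\<^sup>+p. ennreal ((edist d (fst p) (snd p))\<^sup>2) * indicator (space \<gamma>) p \<partial>\<gamma>)
      = (\<integral>\<^sup>+(x, y). ennreal ((edist d x y)\<^sup>2) \<partial>\<gamma>)"
      by (intro nn_integral_cong) (auto simp: case_prod_beta)
    also have "ennreal (1 / \<epsilon>\<^sup>2) * \<dots> \<le> ennreal (1 / \<epsilon>\<^sup>2) * ennreal c"
      by (intro mult_left_mono cost) auto
    also have "\<dots> = ennreal (c / \<epsilon>\<^sup>2)" by (simp add: ennreal_mult'[symmetric])
    also have "{p \<in> space \<gamma>. 1 \<le> ennreal (1 / \<epsilon>\<^sup>2) * ennreal ((edist d (fst p) (snd p))\<^sup>2)} = ?E"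
      using \<epsilon> by (auto simp: ennreal_mult'[symmetric] ennreal_1[symmetric] field_simps simp del: ennreal_1)
    finally show ?thesis using c \<epsilon> by (simp add: emeasure_eq_measure)
  qed
  have "measure \<mu> S1 = measure \<gamma> (fst -` S1 \<inter> space \<gamma>)"
    unfolding m(1)[symmetric] by (rule measure_distr) measurable
  also have "\<dots> \<le> measure \<gamma> ((snd -` S2 \<inter> space \<gamma>) \<union> ?E)"
  proof (rule finite_measure_mono)
    show "fst -` S1 \<inter> space \<gamma> \<subseteq> (snd -` S2 \<inter> space \<gamma>) \<union> ?E"
    proof
      fix p assume p: "p \<in> fst -` S1 \<inter> space \<gamma>"
      show "p \<in> (snd -` S2 \<inter> space \<gamma>) \<union> ?E"
      proof (cases "edist d (fst p) (snd p) < \<epsilon>")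
        case True
        then have "snd p \<in> S2" using p near[of "fst p" "snd p"] by (auto simp: sp)
        then show ?thesis using p by simp
      next
        case False
        then have "\<epsilon>\<^sup>2 \<le> (edist d (fst p) (snd p))\<^sup>2" using \<epsilon> by (intro power_mono) auto
        then show ?thesis using p by simp
      qed
    qed
  qed measurable
  also have "\<dots> \<le> measure \<gamma> (snd -` S2 \<inter> space \<gamma>) + measure \<gamma> ?E"
    by (rule measure_Un_le) measurable
  also have "measure \<gamma> (snd -` S2 \<inter> space \<gamma>) = measure \<nu> S2"
    unfolding m(2)[symmetric] by (rule measure_distr[symmetric]) measurable
  finally show ?thesis using E by simp
qed

text \<open>Up to mass \<open>\<delta>\<close>, \<open>A\<close> lies in
  \<open>{f \<le> \<delta>}\<close>, which the coupling carries into
  \<open>{f \<le> \<delta> + \<epsilon>}\<close> up to the Markov error. Removing a shell leaves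
  \<open>{f < - \<delta>}\<close>, contained in \<open>A\<close> up to mass \<open>\<delta>\<close>.
  The reverse bound is the same argument for complements and superlevel sets.\<close>

lemma convex_coupling_bound_slack:
  assumes d: "d \<ge> 1" and \<mu>: "\<mu> \<in> prob_measures d" and \<gamma>: "\<gamma> \<in> couplings d \<mu> (std_gaussian d)"
    and c: "c \<ge> 0" and cost: "(\<integral>\<^sup>+(x, y). ennreal ((edist d x y)\<^sup>2) \<partial>\<gamma>) \<le> ennreal c"
    and A: "A \<in> sets (euclid d)" "convex_in d A" and \<epsilon>: "\<epsilon> > 0" and \<delta>: "\<delta> > 0"
  shows "\<bar>measure \<mu> A - measure (std_gaussian d) A\<bar>
    \<le> (4 * exp (3 / 2) + 6) * pi * real d powr (1 / 4) * (\<delta> + \<epsilon> / 2) + c / \<epsilon>\<^sup>2 + 2 * \<delta>"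
proof -
  let ?G = "std_gaussian d" and ?K = "(4 * exp (3 / 2) + 6) * pi * real d powr (1 / 4)"
  let ?X = "space (euclid d)"
  have K0: "0 \<le> ?K * (\<delta> + \<epsilon> / 2)" "0 \<le> c / \<epsilon>\<^sup>2" using c \<epsilon> \<delta> by auto
  have S: "M \<in> {\<mu>, ?G} \<Longrightarrow> M \<in> prob_measures d" for M
    using \<mu> std_gaussian_prob_measures[of d] by auto
  have pM: "prob_space M" "sets M = sets (euclid d)" "space M = ?X" if "M \<in> {\<mu>, ?G}" for M
    using S[OF that] by (auto simp: prob_measures_def dest: sets_eq_imp_space_eq)
  have mono: "measure M B \<le> measure M B'"
    if "M \<in> {\<mu>, ?G}" "B \<subseteq> B'" "B' \<in> sets (euclid d)" for M B B'
    using that pM[OF that(1)] by (intro finite_measure.finite_measure_mono) (auto simp: prob_space_def)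
  have sub: "measure M (B \<union> B') \<le> measure M B + measure M B'"
    if "M \<in> {\<mu>, ?G}" "B \<in> sets (euclid d)" "B' \<in> sets (euclid d)" for M B B'
    using that pM[OF that(1)] by (intro measure_Un_le) auto
  have compl: "measure M (?X - B) = 1 - measure M B"
    if "M \<in> {\<mu>, ?G}" "B \<in> sets (euclid d)" for M B
    using prob_space.prob_compl[OF pM(1)[OF that(1)], of B] pM(2,3)[OF that(1)] that(2) by simp
  have restrict: "measure M B \<le> measure M B' + \<delta>"
    if "M \<in> {\<mu>, ?G}" "V \<in> sets (euclid d)" "measure M V \<ge> 1 - \<delta>" "B \<inter> V \<subseteq> B'"
      "B \<in> sets (euclid d)" "B' \<in> sets (euclid d)" for M V B B'
  proof -
    have "B \<subseteq> B' \<union> (?X - V)" using that(4) sets.sets_into_space[OF that(5)] by auto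
    then have "measure M B \<le> measure M (B' \<union> (?X - V))" using that by (intro mono) auto
    also have "\<dots> \<le> measure M B' + measure M (?X - V)" using that by (intro sub) auto
    finally show ?thesis using compl[OF that(1,2)] that(3) by simp
  qed
  show ?thesis
  proof (rule convex_polyhedral_approx[OF d A(2) \<delta>, of "{\<mu>, ?G}"])
    show "finite {\<mu>, ?G}" by simp
    fix V assume V: "V \<in> sets (euclid d)" "\<And>M. M \<in> {\<mu>, ?G} \<Longrightarrow> measure M V \<ge> 1 - \<delta>" "V \<subseteq> A"
    have "1 - \<delta> \<le> measure M A \<and> measure M A \<le> 1" if "M \<in> {\<mu>, ?G}" for M
      using V(2)[OF that] mono[OF that V(3) A(1)] prob_space.prob_le_1[OF pM(1)[OF that], of A] by auto
    from this[of \<mu>] this[of ?G] show ?thesis using K0 \<delta> by (simp add: abs_le_iff)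
  next
    fix V J a b
    assume V: "V \<in> sets (euclid d)" "\<And>M. M \<in> {\<mu>, ?G} \<Longrightarrow> measure M V \<ge> 1 - \<delta>"
      and P: "polyhedral d J a"
      and inner: "\<And>x. x \<in> V \<Longrightarrow> x \<in> A \<Longrightarrow> polyhedral.f d J a b x \<le> \<delta>"
      and outer: "\<And>x. x \<in> V \<Longrightarrow> x \<notin> A \<Longrightarrow> - \<delta> \<le> polyhedral.f d J a b x"
    interpret polyhedral d J a b by fact
    define L where "L r = {x \<in> ?X. f x \<le> r}" for r
    define U where "U r = {x \<in> ?X. r \<le> f x}" for r
    define H where "H s = {x \<in> ?X. \<bar>f x - s\<bar> \<le> \<delta> + \<epsilon> / 2}" for s
    have LUH [measurable]: "L r \<in> sets (euclid d)" "U r \<in> sets (euclid d)" "H r \<in> sets (euclid d)" for r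
      unfolding L_def U_def H_def by measurable
    have strict [measurable]: "{x \<in> ?X. f x < - \<delta>} \<in> sets (euclid d)" "{x \<in> ?X. \<delta> < f x} \<in> sets (euclid d)"
      by measurable
    have H: "measure ?G (H s) \<le> ?K * (\<delta> + \<epsilon> / 2)" for s
      unfolding H_def using \<delta> \<epsilon> by (intro shell_bound) simp
    have sym: "edist d x y = edist d y x" for x y
      by (simp add: edist_def L2_set_def power2_commute)
    have near: "\<bar>f x - f y\<bar> \<le> edist d x y" for x y
      using f_lipschitz[of x y] f_lipschitz[of y x] sym[of x y] by linarith
    have "measure \<mu> A \<le> measure \<mu> (L \<delta>) + \<delta>"
      using V A inner sets.sets_into_space[OF A(1)] by (intro restrict[of _ V]) (auto simp: L_def)
    also have "measure \<mu> (L \<delta>) \<le> measure ?G (L (\<delta> + \<epsilon>)) + c / \<epsilon>\<^sup>2"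
    proof (rule coupling_measure_le[OF \<gamma> \<epsilon> c cost])
      fix x y assume "x \<in> L \<delta>" "y \<in> ?X" "edist d x y < \<epsilon>"
      then show "y \<in> L (\<delta> + \<epsilon>)" using near[of x y] by (auto simp: L_def)
    qed auto
    \<comment> \<open>The shell is \<open>- \<delta> \<le> f \<le> \<delta> + \<epsilon>\<close>,
      with centre \<open>\<epsilon> / 2\<close> and half-width
      \<open>\<delta> + \<epsilon> / 2\<close>.\<close>
    also have "measure ?G (L (\<delta> + \<epsilon>)) \<le> measure ?G ({x \<in> ?X. f x < - \<delta>} \<union> H (\<epsilon> / 2))"
      using \<delta> \<epsilon> by (intro mono) (auto simp: L_def H_def abs_le_iff)
    also have "\<dots> \<le> measure ?G {x \<in> ?X. f x < - \<delta>} + measure ?G (H (\<epsilon> / 2))"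
      by (intro sub) auto
    also have "measure ?G {x \<in> ?X. f x < - \<delta>} \<le> measure ?G A + \<delta>"
      using V A outer by (intro restrict[of _ V]) force+
    finally have 1: "measure \<mu> A \<le> measure ?G A + ?K * (\<delta> + \<epsilon> / 2) + c / \<epsilon>\<^sup>2 + 2 * \<delta>"
      using H[of "\<epsilon> / 2"] by simp
    have "measure \<mu> (?X - A) \<le> measure \<mu> (U (- \<delta>)) + \<delta>"
      using V A outer by (intro restrict[of _ V]) (auto simp: U_def)
    also have "measure \<mu> (U (- \<delta>)) \<le> measure ?G (U (- \<delta> - \<epsilon>)) + c / \<epsilon>\<^sup>2"
    proof (rule coupling_measure_le[OF \<gamma> \<epsilon> c cost])
      fix x y assume "x \<in> U (- \<delta>)" "y \<in> ?X" "edist d x y < \<epsilon>"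
      then show "y \<in> U (- \<delta> - \<epsilon>)" using near[of x y] by (auto simp: U_def)
    qed auto
    also have "measure ?G (U (- \<delta> - \<epsilon>)) \<le> measure ?G ({x \<in> ?X. \<delta> < f x} \<union> H (- \<epsilon> / 2))"
      using \<delta> \<epsilon> by (intro mono) (auto simp: U_def H_def abs_le_iff)
    also have "\<dots> \<le> measure ?G {x \<in> ?X. \<delta> < f x} + measure ?G (H (- \<epsilon> / 2))"
      by (intro sub) auto
    also have "measure ?G {x \<in> ?X. \<delta> < f x} \<le> measure ?G (?X - A) + \<delta>"
      using V A inner by (intro restrict[of _ V]) force+
    finally have 2: "measure \<mu> (?X - A) \<le> measure ?G (?X - A) + ?K * (\<delta> + \<epsilon> / 2) + c / \<epsilon>\<^sup>2 + 2 * \<delta>"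
      using H[of "- \<epsilon> / 2"] by simp
    show ?thesis using 1 2 compl[of \<mu> A] compl[of ?G A] A by (simp add: abs_le_iff)
  qed (use S in auto)
qed

lemma convex_coupling_bound:
  assumes d: "d \<ge> 1" and \<mu>: "\<mu> \<in> prob_measures d" and \<gamma>: "\<gamma> \<in> couplings d \<mu> (std_gaussian d)"
    and c: "c > 0" and cost: "(\<integral>\<^sup>+(x, y). ennreal ((edist d x y)\<^sup>2) \<partial>\<gamma>) \<le> ennreal c"
  shows "Delta_CI d \<mu> (std_gaussian d)
    \<le> ((2 * exp (3 / 2) + 3) * pi + 1) * real d powr (1 / 6) * c powr (1 / 3)"
  unfolding Delta_CI_def
proof (rule cSUP_least)
  show "{A \<in> sets (euclid d). convex_in d A} \<noteq> {}"
    by (auto intro!: exI[of _ "{}"] simp: convex_in_def)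
  fix A assume A: "A \<in> {A \<in> sets (euclid d). convex_in d A}"
  let ?K = "(4 * exp (3 / 2) + 6) * pi * real d powr (1 / 4)"
  let ?\<Delta> = "\<bar>measure \<mu> A - measure (std_gaussian d) A\<bar>"
  \<comment> \<open>Up to constants, this balances the shell term
    \<open>d powr (1 / 4) * \<epsilon>\<close> against the Markov term
    \<open>c / \<epsilon>^2\<close>. The approximation error \<open>\<delta>\<close> is sent to 0
    afterwards, with \<open>\<epsilon>\<close> fixed.\<close>
  define \<epsilon> where "\<epsilon> = real d powr (- 1 / 12) * c powr (1 / 3)"
  have d0: "real d > 0" using d by simp
  have \<epsilon>: "\<epsilon> > 0" using d0 c by (simp add: \<epsilon>_def)
  have "((\<lambda>\<delta>. ?K * (\<delta> + \<epsilon> / 2) + c / \<epsilon>\<^sup>2 + 2 * \<delta>) \<longlongrightarrow> ?K * (0 + \<epsilon> / 2) + c / \<epsilon>\<^sup>2 + 2 * 0) (at_right 0)"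
    by (intro tendsto_intros)
  moreover have "\<forall>\<^sub>F \<delta> in at_right 0. ?\<Delta> \<le> ?K * (\<delta> + \<epsilon> / 2) + c / \<epsilon>\<^sup>2 + 2 * \<delta>"
    using eventually_at_right_less
    by eventually_elim (use A c \<epsilon> in \<open>auto intro!: convex_coupling_bound_slack[OF d \<mu> \<gamma> _ cost]\<close>)
  ultimately have "?\<Delta> \<le> ?K * (0 + \<epsilon> / 2) + c / \<epsilon>\<^sup>2 + 2 * 0"
    by (intro tendsto_lowerbound) auto
  moreover have "c / \<epsilon>\<^sup>2 = real d powr (1 / 6) * c powr (1 / 3)"
  proof -
    have "\<epsilon>\<^sup>2 = real d powr (- 1 / 6) * c powr (2 / 3)"
      using d0 c by (simp add: \<epsilon>_def power2_eq_square powr_add[symmetric] mult_ac)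
    moreover have "c powr (2 / 3) * c powr (1 / 3) = c" "real d powr (- 1 / 6) * real d powr (1 / 6) = 1"
      using d0 c by (simp_all add: powr_add[symmetric])
    ultimately have "c = \<epsilon>\<^sup>2 * (real d powr (1 / 6) * c powr (1 / 3))"
      by (simp add: mult_ac)
    then show ?thesis using \<epsilon> by (metis nonzero_mult_div_cancel_left power_not_zero less_imp_neq)
  qed
  moreover have "real d powr (1 / 4) * \<epsilon> = real d powr (1 / 6) * c powr (1 / 3)"
    by (simp add: \<epsilon>_def mult.assoc[symmetric] powr_add[symmetric])
  then have "?K * (0 + \<epsilon> / 2) = (2 * exp (3 / 2) + 3) * pi * (real d powr (1 / 6) * c powr (1 / 3))"
    by (simp add: algebra_simps)
  ultimately show "?\<Delta> \<le> ((2 * exp (3 / 2) + 3) * pi + 1) * real d powr (1 / 6) * c powr (1 / 3)"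
    by (simp add: algebra_simps)
qed

theorem proposition1p4:
  shows "\<exists>C::real. C > 0 \<and> (\<forall>d::nat. d \<ge> 1 \<longrightarrow> (\<forall>\<mu> \<in> prob_measures d.
    ennreal (Delta_CI d \<mu> (std_gaussian d))
      \<le> ennreal (C * real d powr (1 / 6)) * ennpowr (W2 d \<mu> (std_gaussian d)) (2 / 3)))"
proof (intro exI conjI allI impI ballI)
  let ?C = "(2 * exp (3 / 2) + 3) * pi + 1 :: real"
  have "0 \<le> (2 * exp (3 / 2) + 3) * pi" by simp
  then show C: "0 < ?C" by linarith
  fix d \<mu> assume d: "d \<ge> 1" and \<mu>: "\<mu> \<in> prob_measures d"
  let ?G = "std_gaussian d"
  define I where "I = (INF \<gamma> \<in> couplings d \<mu> ?G. \<integral>\<^sup>+ (x, y). ennreal ((edist d x y)\<^sup>2) \<partial>\<gamma>)"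
  have K: "?C * real d powr (1 / 6) > 0" using C d by simp
  show "ennreal (Delta_CI d \<mu> ?G) \<le> ennreal (?C * real d powr (1 / 6)) * ennpowr (W2 d \<mu> ?G) (2 / 3)"
  proof (cases "I = \<infinity>")
    case True
    then show ?thesis
      using C d by (auto simp: W2_def I_def[symmetric] ennpowr_def ennreal_mult_top)
  next
    case False
    then obtain r where r: "0 \<le> r" "I = ennreal r" by (cases I) auto
    \<comment> \<open>Working with every \<open>c > r\<close> avoids the existence of an optimal
      coupling and keeps the cost bound positive even when \<open>r = 0\<close>.\<close>
    have le: "Delta_CI d \<mu> ?G \<le> ?C * real d powr (1 / 6) * c powr (1 / 3)" if c: "c > r" for c
    proof -
      have "I < ennreal c" using c r by (simp add: ennreal_lessI)
      then obtain \<gamma> where "\<gamma> \<in> couplings d \<mu> ?G" "(\<integral>\<^sup>+ (x, y). ennreal ((edist d x y)\<^sup>2) \<partial>\<gamma>) < ennreal c"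
        unfolding I_def INF_less_iff by blast
      then show ?thesis using c r by (intro convex_coupling_bound d \<mu>) auto
    qed
    \<comment> \<open>Letting \<open>c\<close> decrease to \<open>r\<close> needs continuity of the
      cube root from the right, also at 0.\<close>
    have "((\<lambda>c. ?C * real d powr (1 / 6) * c powr (1 / 3)) \<longlongrightarrow> ?C * real d powr (1 / 6) * r powr (1 / 3)) (at_right r)"
    proof (intro tendsto_intros tendsto_powr')
      show "r \<noteq> 0 \<or> 0 < (1 / 3 :: real) \<and> (\<forall>\<^sub>F x in at_right r. 0 \<le> x)"
        using r eventually_at_right_less[of r] by (auto elim!: eventually_mono)
    qed
    moreover have "\<forall>\<^sub>F c in at_right r. Delta_CI d \<mu> ?G \<le> ?C * real d powr (1 / 6) * c powr (1 / 3)"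
      using eventually_at_right_less[of r] by eventually_elim (rule le)
    ultimately have "Delta_CI d \<mu> ?G \<le> ?C * real d powr (1 / 6) * r powr (1 / 3)"
      by (intro tendsto_lowerbound) auto
    \<comment> \<open>\<open>I\<close> is the squared distance, so the exponents combine to
      \<open>1 / 2 * (2 / 3) = 1 / 3\<close>.\<close>
    moreover have "ennpowr (W2 d \<mu> ?G) (2 / 3) = ennreal (r powr (1 / 3))"
      unfolding W2_def I_def[symmetric] using r by (simp add: ennpowr_def powr_powr)
    ultimately show ?thesis
      using K by (simp only: ennreal_mult'[symmetric] less_imp_le ennreal_leI)
  qed
qed

end
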